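(* Let $m,p,q\ge1$ be integers and $\sigma_1,\sigma_2,\sigma_3\in\{\pm1\}$ with $(m,\sigma_1)\ne(1,1)$ and $(p,\sigma_2)\neq(1,1)$. If the weight $w=m+p+q$ and the integer $\frac{1-\sigma_1\sigma_3}{2}$ have the same parity, then the triple $T$-value $T(m,p,q;\sigma_1,\sigma_2,\sigma_3)$ is reducible to combinations of (i.e. is a polynomial with rational coefficients in) (alternating) zeta values, the Dirichlet beta values, (alternating) linear Euler $R$-sums and (alternating) double $T$-values.
   Context: The (alternating) Kaneko-Tsumura $T$-values used are $T(m,p,q;\sigma_1,\sigma_2,\sigma_3)=8\sum_{n_1>n_2>n_3\ge1}\frac{\sigma_1^{n_1}\sigma_2^{n_2}\sigma_3^{n_3}}{(2n_1-3)^m(2n_2-2)^p(2n_3-1)^q}$ for $(m,\sigma_1)\ne(1,1)$ and $T(p,q;\sigma_1,\sigma_2)=4\sum_{n_1>n_2\ge1}\frac{\sigma_1^{n_1}\sigma_2^{n_2}}{(2n_1-2)^p(2n_2-1)^q}$ for $(p,\sigma_1)\ne(1,1)$, sums over $n_1$ being outermost (limits of partial sums). With $H_n^{(r)}(\sigma)=\sum_{k=1}^n\frac{\sigma^{k-1}}{k^r}$, the linear Euler $R$-sums are $R_{p,q}^{\sigma_1,\sigma_2}=\sum_{n\ge1}\sigma_2^{n-1}\frac{H_{n-1}^{(p)}(\sigma_1)}{(n-1/2)^q}$, $(q,\sigma_2)\ne(1,1)$. Zeta values are $\zeta(s;\sigma)=\sum_{n\ge1}\frac{\sigma^n}{n^s}$,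 $\sigma\in\{\pm1\}$, $(s,\sigma)\neq(1,1)$ (in particular $\zeta(1;-1)=-\ln2$); Dirichlet beta values are $\beta(s)=\sum_{n\ge1}\frac{(-1)^{n-1}}{(2n-1)^s}$, $s\ge1$ (in particular $\beta(1)=\pi/4$). *)

theory Defs
  imports Complex_Main
begin

definition alt_zeta :: "nat \<Rightarrow> int \<Rightarrow> real" where
  "alt_zeta s \<sigma> = (\<Sum>n. of_int \<sigma> ^ Suc n / real (Suc n) ^ s)"

definition dirichlet_beta :: "nat \<Rightarrow> real" where
  "dirichlet_beta s = (\<Sum>n. (-1) ^ n / (2 * real (Suc n) - 1) ^ s)"

definition alt_harmonic :: "nat \<Rightarrow> nat \<Rightarrow> int \<Rightarrow> real" where
  "alt_harmonic n r \<sigma> = (\<Sum>k=1..n. of_int \<sigma> ^ (k - 1) / real k ^ r)"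

text \<open>The summation index is shifted to start at 0: the term for \<open>n\<close> below is the
  one with \<open>\<sigma>2^n H_n / (n + 1/2)^q\<close>, where \<open>H\<close> carries \<open>p\<close> and \<open>\<sigma>1\<close>.\<close>

definition R_sum :: "nat \<Rightarrow> nat \<Rightarrow> int \<Rightarrow> int \<Rightarrow> real" where
  "R_sum p q \<sigma>1 \<sigma>2 =
     (\<Sum>n. of_int \<sigma>2 ^ n * alt_harmonic n p \<sigma>1 / (real (Suc n) - 1 / 2) ^ q)"

text \<open>The \<open>T\<close>-values are in general only conditionally convergent; they are limits of the
  partial sums over the outermost index \<open>n1\<close>. The terms with \<open>n1\<close> too small to
  admit \<open>n1 > n2 (> n3) \<ge> 1\<close> are empty inner sums.\<close>

definition T_double :: "nat \<Rightarrow> nat \<Rightarrow> int \<Rightarrow> int \<Rightarrow> real" where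
  "T_double p q \<sigma>1 \<sigma>2 =
     4 * (\<Sum>n1. \<Sum>n2\<in>{1..<n1}.
            of_int \<sigma>1 ^ n1 * of_int \<sigma>2 ^ n2 /
            ((2 * real n1 - 2) ^ p * (2 * real n2 - 1) ^ q))"

definition T_triple :: "nat \<Rightarrow> nat \<Rightarrow> nat \<Rightarrow> int \<Rightarrow> int \<Rightarrow> int \<Rightarrow> real" where
  "T_triple m p q \<sigma>1 \<sigma>2 \<sigma>3 =
     8 * (\<Sum>n1. \<Sum>n2\<in>{1..<n1}. \<Sum>n3\<in>{1..<n2}.
            of_int \<sigma>1 ^ n1 * of_int \<sigma>2 ^ n2 * of_int \<sigma>3 ^ n3 /
            ((2 * real n1 - 3) ^ m * (2 * real n2 - 2) ^ p * (2 * real n3 - 1) ^ q))"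

definition alt_zeta_values :: "real set" where
  "alt_zeta_values =
     {alt_zeta s \<sigma> |s \<sigma>. s \<ge> 1 \<and> \<sigma> \<in> {1, -1} \<and> (s, \<sigma>) \<noteq> (1, 1)}"

definition beta_values :: "real set" where
  "beta_values = {dirichlet_beta s |s. s \<ge> 1}"

definition R_sum_values :: "real set" where
  "R_sum_values =
     {R_sum p q \<sigma>1 \<sigma>2 |p q \<sigma>1 \<sigma>2.
        p \<ge> 1 \<and> q \<ge> 1 \<and> \<sigma>1 \<in> {1, -1} \<and> \<sigma>2 \<in> {1, -1} \<and> (q, \<sigma>2) \<noteq> (1, 1)}"

definition T_double_values :: "real set" where
  "T_double_values =
     {T_double p q \<sigma>1 \<sigma>2 |p q \<sigma>1 \<sigma>2.
        p \<ge> 1 \<and> q \<ge> 1 \<and> \<sigma>1 \<in> {1, -1} \<and> \<sigma>2 \<in> {1, -1} \<and> (p, \<sigma>1) \<noteq> (1, 1)}"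

text \<open>A polynomial expression over the rationals in elements of \<open>S\<close> is given as a finite list
  of terms, each a rational coefficient with a monomial (the list of its factors,
  with repetition).\<close>

definition rational_polynomial_in :: "real set \<Rightarrow> real \<Rightarrow> bool" where
  "rational_polynomial_in S x \<longleftrightarrow>
     (\<exists>ts :: (rat \<times> real list) list.
        (\<forall>(c, vs)\<in>set ts. set vs \<subseteq> S) \<and>
        x = (\<Sum>(c, vs)\<leftarrow>ts. of_rat c * prod_list vs))"

end

theory Submission
  imports Defs "HOL-Analysis.Analysis" "HOL-Real_Asymp.Real_Asymp"
begin

text \<open>
  Write \<open>a = 2x + 1\<close>, \<open>b = 2y\<close>, \<open>c = 2z + 1\<close>, so that \<open>T_triple\<close> is, up to a factor \<open>\<plusminus>8\<close>,
  the sum of \<open>f1(a) f2(b) f3(c)\<close> over \<open>a > b > c > 0\<close>. Consider instead the sum over all integers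
  \<open>b \<noteq> 0\<close>, \<open>a > b > c\<close>, taken symmetrically in \<open>b\<close> (with the harmonic divergence in \<open>c\<close> removed
  if \<open>q = 1\<close>, \<open>\<sigma>3 = 1\<close>). Reflecting \<open>b \<mapsto> -b\<close> turns the inner sums into constants minus themselves,
  up to signs; the parity hypothesis says that the product of the three signs is 1, so this sum is
  twice the triple sum plus products of sums of lower depth.

  On the other hand \<open>1 / (a^m b^p c^q)\<close> splits into partial fractions with a single pole at \<open>a\<close>,
  \<open>b\<close> or \<open>c\<close> times powers of two of the differences \<open>a - b\<close>, \<open>b - c\<close>, \<open>a - c\<close>. Translation
  invariance then factors each contribution into a one-variable sum over the pole and a double sum
  over the differences; omitting \<open>b = 0\<close> only subtracts another double sum.
\<close>

section \<open>Rational polynomial expressions\<close>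

text \<open>The three reflection signs are \<open>s1 * (-1) ^ m\<close>, \<open>(-1) ^ p\<close> and
  \<open>s3 * (-1) ^ q\<close>: negating 2x+1 means x -> -1-x, an odd index shift that costs one
  factor s, whereas y -> -y leaves \<open>s2 powi y\<close> alone. Hence only \<sigma>1, \<sigma>3
  and the weight enter the parity condition. The obstacle is that the sums converge only
  conditionally in general, so no rearrangement is free. The order is fixed: c to minus infinity,
  then a to plus infinity, then b in symmetric windows. Moving to the pole pairs a weight in the
  gaps with far translates of 1/(2x+1)^t; for t = 1 this is square-summable but not summable, so the
  argument is an l2 one and needs weights with square-summable tails. For q = 1, \<sigma>3 = 1 a
  multiple of one and the same partial sum of 1/(2j+1) is removed everywhere; odd and even
  reciprocals then differ by zeta(1;-1) = -ln 2, so no new constants appear. A double sum whose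
  larger number is even is a double T-value; with the odd number larger it is an R-sum.\<close>

lemma rational_polynomial_in_add:
  assumes "rational_polynomial_in S x" "rational_polynomial_in S y"
  shows "rational_polynomial_in S (x + y)"
proof -
  from assms obtain ts us where
    "\<forall>(c, vs)\<in>set ts. set vs \<subseteq> S" "x = (\<Sum>(c, vs)\<leftarrow>ts. of_rat c * prod_list vs)"
    "\<forall>(c, vs)\<in>set us. set vs \<subseteq> S" "y = (\<Sum>(c, vs)\<leftarrow>us. of_rat c * prod_list vs)"
    unfolding rational_polynomial_in_def by blast
  then show ?thesis
    unfolding rational_polynomial_in_def by (intro exI[of _ "ts @ us"]) auto
qed

lemma rational_polynomial_in_monomial:
  assumes "set vs \<subseteq> S"
  shows "rational_polynomial_in S (of_rat c * prod_list vs)"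
  unfolding rational_polynomial_in_def using assms by (intro exI[of _ "[(c, vs)]"]) auto

lemma rational_polynomial_in_of_rat: "rational_polynomial_in S (of_rat c)"
  using rational_polynomial_in_monomial[of "[]" S c] by simp

lemma rational_polynomial_in_base: "x \<in> S \<Longrightarrow> rational_polynomial_in S x"
  using rational_polynomial_in_monomial[of "[x]" S 1] by simp

lemma rational_polynomial_in_Rats: "x \<in> \<rat> \<Longrightarrow> rational_polynomial_in S x"
  by (auto elim!: Rats_cases intro: rational_polynomial_in_of_rat)

lemma rational_polynomial_in_monomial_mult:
  assumes "set ws \<subseteq> S" "\<forall>(c, vs)\<in>set ts. set vs \<subseteq> S"
  shows "rational_polynomial_in S
    (of_rat d * prod_list ws * (\<Sum>(c, vs)\<leftarrow>ts. of_rat c * prod_list vs))"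
  using assms(2)
proof (induction ts)
  case Nil
  show ?case using rational_polynomial_in_of_rat[of S 0] by simp
next
  case (Cons t ts)
  obtain c vs where t: "t = (c, vs)" by fastforce
  have "rational_polynomial_in S (of_rat (d * c) * prod_list (ws @ vs))"
    using assms(1) Cons.prems t by (intro rational_polynomial_in_monomial) auto
  from rational_polynomial_in_add[OF this Cons.IH] Cons.prems show ?case
    by (simp add: t algebra_simps of_rat_mult)
qed

lemma rational_polynomial_in_mult:
  assumes "rational_polynomial_in S x" "rational_polynomial_in S y"
  shows "rational_polynomial_in S (x * y)"
proof -
  from assms obtain ts us where ts: "\<forall>(c, vs)\<in>set ts. set vs \<subseteq> S"
    and x: "x = (\<Sum>(c, vs)\<leftarrow>ts. of_rat c * prod_list vs)"
    and us: "\<forall>(c, vs)\<in>set us. set vs \<subseteq> S"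
    and y: "y = (\<Sum>(c, vs)\<leftarrow>us. of_rat c * prod_list vs)"
    unfolding rational_polynomial_in_def by blast
  from ts have "rational_polynomial_in S ((\<Sum>(c, vs)\<leftarrow>ts. of_rat c * prod_list vs) * y)"
  proof (induction ts)
    case Nil
    show ?case using rational_polynomial_in_of_rat[of S 0] by simp
  next
    case (Cons t ts)
    obtain d ws where t: "t = (d, ws)" by fastforce
    have "rational_polynomial_in S (of_rat d * prod_list ws * y)"
      unfolding y using Cons.prems us t by (intro rational_polynomial_in_monomial_mult) auto
    from rational_polynomial_in_add[OF this Cons.IH] Cons.prems show ?case
      by (simp add: t algebra_simps)
  qed
  then show ?thesis by (simp add: x)
qed

lemma rational_polynomial_in_scale:
  "c \<in> \<rat> \<Longrightarrow> rational_polynomial_in S x \<Longrightarrow> rational_polynomial_in S (c * x)"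
  by (blast intro: rational_polynomial_in_mult rational_polynomial_in_Rats)

lemma rational_polynomial_in_diff:
  assumes "rational_polynomial_in S x" "rational_polynomial_in S y"
  shows "rational_polynomial_in S (x - y)"
  using rational_polynomial_in_add[OF assms(1) rational_polynomial_in_scale[of "-1", OF _ assms(2)]]
  by simp

section \<open>Partial fractions in three variables\<close>

text \<open>In every term each gap keeps at least the exponent of its endpoint that is not the pole.
  The gap also inherits that endpoint's sign, so the conditions on (m, s1) and (p, s2) pass to it,
  and a gap series with sign s3 can diverge only if q = 1.\<close>

inductive parfrac_span ::
  "nat \<Rightarrow> nat \<Rightarrow> nat \<Rightarrow> (real \<Rightarrow> real \<Rightarrow> real \<Rightarrow> real) \<Rightarrow> bool"
  for m p q where
  pole_fst: "t \<ge> 1 \<Longrightarrow> u \<ge> p \<Longrightarrow> v \<ge> q \<Longrightarrow> parfrac_span m p q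
    (\<lambda>a b c. inverse a ^ t * inverse (a - b) ^ u * inverse (a - c) ^ v)"
| pole_snd: "t \<ge> 1 \<Longrightarrow> u \<ge> m \<Longrightarrow> v \<ge> q \<Longrightarrow> parfrac_span m p q
    (\<lambda>a b c. inverse b ^ t * inverse (a - b) ^ u * inverse (b - c) ^ v)"
| pole_trd: "t \<ge> 1 \<Longrightarrow> u \<ge> p \<Longrightarrow> v \<ge> m \<Longrightarrow> parfrac_span m p q
    (\<lambda>a b c. inverse c ^ t * inverse (b - c) ^ u * inverse (a - c) ^ v)"
| add: "parfrac_span m p q F \<Longrightarrow> parfrac_span m p q G \<Longrightarrow>
    parfrac_span m p q (\<lambda>a b c. F a b c + G a b c)"
| scale: "parfrac_span m p q F \<Longrightarrow> parfrac_span m p q (\<lambda>a b c. of_rat r * F a b c)"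

lemma parfrac_span_lincomb3:
  assumes "parfrac_span m p q F" "parfrac_span m p q G" "parfrac_span m p q H"
  shows "parfrac_span m p q
    (\<lambda>a b c. of_rat r * F a b c + of_rat s * G a b c + of_rat t * H a b c)"
  by (intro parfrac_span.add parfrac_span.scale assms)

definition generic_triple :: "real \<Rightarrow> real \<Rightarrow> real \<Rightarrow> bool" where
  "generic_triple a b c \<longleftrightarrow>
     a \<noteq> 0 \<and> b \<noteq> 0 \<and> c \<noteq> 0 \<and> a \<noteq> b \<and> b \<noteq> c \<and> a \<noteq> c"

lemma DERIV_inverse_power_sub:
  fixes b :: real
  assumes "x \<noteq> b"
  shows "((\<lambda>x. inverse (x - b) ^ n) has_real_derivative - real n * inverse (x - b) ^ Suc n) (at x)"
proof -
  have "((\<lambda>x. inverse (x - b)) has_real_derivative - (inverse (x - b) * 1 * inverse (x - b))) (at x)"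
    using assms by (intro DERIV_inverse') (auto intro!: derivative_eq_intros)
  from DERIV_power[OF this, of n] show ?thesis
    by (rule DERIV_cong) (cases n; simp add: algebra_simps)
qed

lemma DERIV_inverse_power_sub':
  fixes b :: real
  assumes "x \<noteq> b"
  shows "((\<lambda>x. inverse (b - x) ^ n) has_real_derivative real n * inverse (b - x) ^ Suc n) (at x)"
proof -
  have "((\<lambda>x. inverse (b - x)) has_real_derivative - (inverse (b - x) * (- 1) * inverse (b - x))) (at x)"
    using assms by (intro DERIV_inverse') (auto intro!: derivative_eq_intros)
  from DERIV_power[OF this, of n] show ?thesis
    by (rule DERIV_cong) (cases n; simp add: algebra_simps)
qed

lemmas DERIV_inverse_power = DERIV_inverse_power_sub[of _ 0, simplified]

text \<open>In terms with pole b or c the first variable occurs only in the gap to a, so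
  differentiation raises exactly the exponent bounded by m; in terms with pole a no bound involves
  m. The other two variables behave in the same way.\<close>

lemma parfrac_span_DERIV_fst:
  assumes "parfrac_span m p q F"
  shows "\<exists>F'. parfrac_span (Suc m) p q F' \<and> (\<forall>a b c. generic_triple a b c \<longrightarrow>
    ((\<lambda>x. F x b c) has_real_derivative F' a b c) (at a))"
  using assms
proof induction
  case (pole_fst t u v)
  let ?F' = "\<lambda>a b c. of_rat (- of_nat t) * (inverse a ^ Suc t * inverse (a - b) ^ u * inverse (a - c) ^ v)
     + of_rat (- of_nat u) * (inverse a ^ t * inverse (a - b) ^ Suc u * inverse (a - c) ^ v)
     + of_rat (- of_nat v) * (inverse a ^ t * inverse (a - b) ^ u * inverse (a - c) ^ Suc v)"
  have "parfrac_span (Suc m) p q ?F'"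
    using pole_fst by (intro parfrac_span_lincomb3 parfrac_span.pole_fst) auto
  moreover have "generic_triple a b c \<Longrightarrow> ((\<lambda>x. inverse x ^ t * inverse (x - b) ^ u * inverse (x - c) ^ v)
      has_real_derivative ?F' a b c) (at a)" for a b c
    unfolding generic_triple_def
    by (rule DERIV_cong, (rule DERIV_mult DERIV_inverse_power DERIV_inverse_power_sub
          DERIV_inverse_power_sub' DERIV_const | simp (no_asm_simp))+)
      (simp add: of_rat_minus algebra_simps)?
  ultimately show ?case by blast
next
  case (pole_snd t u v)
  let ?F' = "\<lambda>a b c. of_rat (- of_nat u) * (inverse b ^ t * inverse (a - b) ^ Suc u * inverse (b - c) ^ v)"
  have "parfrac_span (Suc m) p q ?F'"
    using pole_snd by (intro parfrac_span.scale parfrac_span.pole_snd) auto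
  moreover have "generic_triple a b c \<Longrightarrow> ((\<lambda>x. inverse b ^ t * inverse (x - b) ^ u * inverse (b - c) ^ v)
      has_real_derivative ?F' a b c) (at a)" for a b c
    unfolding generic_triple_def
    by (rule DERIV_cong, (rule DERIV_mult DERIV_inverse_power DERIV_inverse_power_sub
          DERIV_inverse_power_sub' DERIV_const | simp (no_asm_simp))+)
      (simp add: of_rat_minus algebra_simps)?
  ultimately show ?case by blast
next
  case (pole_trd t u v)
  let ?F' = "\<lambda>a b c. of_rat (- of_nat v) * (inverse c ^ t * inverse (b - c) ^ u * inverse (a - c) ^ Suc v)"
  have "parfrac_span (Suc m) p q ?F'"
    using pole_trd by (intro parfrac_span.scale parfrac_span.pole_trd) auto
  moreover have "generic_triple a b c \<Longrightarrow> ((\<lambda>x. inverse c ^ t * inverse (b - c) ^ u * inverse (x - c) ^ v)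
      has_real_derivative ?F' a b c) (at a)" for a b c
    unfolding generic_triple_def
    by (rule DERIV_cong, (rule DERIV_mult DERIV_inverse_power DERIV_inverse_power_sub
          DERIV_inverse_power_sub' DERIV_const | simp (no_asm_simp))+)
      (simp add: of_rat_minus algebra_simps)?
  ultimately show ?case by blast
next
  case (add F G)
  then obtain F' G' where "parfrac_span (Suc m) p q F'" "parfrac_span (Suc m) p q G'"
    and "\<And>a b c. generic_triple a b c \<Longrightarrow> ((\<lambda>x. F x b c) has_real_derivative F' a b c) (at a)"
    and "\<And>a b c. generic_triple a b c \<Longrightarrow> ((\<lambda>x. G x b c) has_real_derivative G' a b c) (at a)"
    by blast
  then show ?case
    by (intro exI[of _ "\<lambda>a b c. F' a b c + G' a b c"]) (auto intro: parfrac_span.add DERIV_add)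
next
  case (scale F r)
  then obtain F' where "parfrac_span (Suc m) p q F'"
    and "\<And>a b c. generic_triple a b c \<Longrightarrow> ((\<lambda>x. F x b c) has_real_derivative F' a b c) (at a)"
    by blast
  then show ?case
    by (intro exI[of _ "\<lambda>a b c. of_rat r * F' a b c"]) (auto intro: parfrac_span.scale DERIV_cmult)
qed

lemma parfrac_span_DERIV_snd:
  assumes "parfrac_span m p q F"
  shows "\<exists>F'. parfrac_span m (Suc p) q F' \<and> (\<forall>a b c. generic_triple a b c \<longrightarrow>
    ((\<lambda>x. F a x c) has_real_derivative F' a b c) (at b))"
  using assms
proof induction
  case (pole_fst t u v)
  let ?F' = "\<lambda>a b c. of_rat (of_nat u) * (inverse a ^ t * inverse (a - b) ^ Suc u * inverse (a - c) ^ v)"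
  have "parfrac_span m (Suc p) q ?F'"
    using pole_fst by (intro parfrac_span.scale parfrac_span.pole_fst) auto
  moreover have "generic_triple a b c \<Longrightarrow> ((\<lambda>x. inverse a ^ t * inverse (a - x) ^ u * inverse (a - c) ^ v)
      has_real_derivative ?F' a b c) (at b)" for a b c
    unfolding generic_triple_def
    by (rule DERIV_cong, (rule DERIV_mult DERIV_inverse_power DERIV_inverse_power_sub
          DERIV_inverse_power_sub' DERIV_const | simp (no_asm_simp))+)
      (simp add: of_rat_minus algebra_simps)?
  ultimately show ?case by blast
next
  case (pole_snd t u v)
  let ?F' = "\<lambda>a b c. of_rat (- of_nat t) * (inverse b ^ Suc t * inverse (a - b) ^ u * inverse (b - c) ^ v)
     + of_rat (of_nat u) * (inverse b ^ t * inverse (a - b) ^ Suc u * inverse (b - c) ^ v)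
     + of_rat (- of_nat v) * (inverse b ^ t * inverse (a - b) ^ u * inverse (b - c) ^ Suc v)"
  have "parfrac_span m (Suc p) q ?F'"
    using pole_snd by (intro parfrac_span_lincomb3 parfrac_span.pole_snd) auto
  moreover have "generic_triple a b c \<Longrightarrow> ((\<lambda>x. inverse x ^ t * inverse (a - x) ^ u * inverse (x - c) ^ v)
      has_real_derivative ?F' a b c) (at b)" for a b c
    unfolding generic_triple_def
    by (rule DERIV_cong, (rule DERIV_mult DERIV_inverse_power DERIV_inverse_power_sub
          DERIV_inverse_power_sub' DERIV_const | simp (no_asm_simp))+)
      (simp add: of_rat_minus algebra_simps)?
  ultimately show ?case by blast
next
  case (pole_trd t u v)
  let ?F' = "\<lambda>a b c. of_rat (- of_nat u) * (inverse c ^ t * inverse (b - c) ^ Suc u * inverse (a - c) ^ v)"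
  have "parfrac_span m (Suc p) q ?F'"
    using pole_trd by (intro parfrac_span.scale parfrac_span.pole_trd) auto
  moreover have "generic_triple a b c \<Longrightarrow> ((\<lambda>x. inverse c ^ t * inverse (x - c) ^ u * inverse (a - c) ^ v)
      has_real_derivative ?F' a b c) (at b)" for a b c
    unfolding generic_triple_def
    by (rule DERIV_cong, (rule DERIV_mult DERIV_inverse_power DERIV_inverse_power_sub
          DERIV_inverse_power_sub' DERIV_const | simp (no_asm_simp))+)
      (simp add: of_rat_minus algebra_simps)?
  ultimately show ?case by blast
next
  case (add F G)
  then obtain F' G' where "parfrac_span m (Suc p) q F'" "parfrac_span m (Suc p) q G'"
    and "\<And>a b c. generic_triple a b c \<Longrightarrow> ((\<lambda>x. F a x c) has_real_derivative F' a b c) (at b)"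
    and "\<And>a b c. generic_triple a b c \<Longrightarrow> ((\<lambda>x. G a x c) has_real_derivative G' a b c) (at b)"
    by blast
  then show ?case
    by (intro exI[of _ "\<lambda>a b c. F' a b c + G' a b c"]) (auto intro: parfrac_span.add DERIV_add)
next
  case (scale F r)
  then obtain F' where "parfrac_span m (Suc p) q F'"
    and "\<And>a b c. generic_triple a b c \<Longrightarrow> ((\<lambda>x. F a x c) has_real_derivative F' a b c) (at b)"
    by blast
  then show ?case
    by (intro exI[of _ "\<lambda>a b c. of_rat r * F' a b c"]) (auto intro: parfrac_span.scale DERIV_cmult)
qed

lemma parfrac_span_DERIV_trd:
  assumes "parfrac_span m p q F"
  shows "\<exists>F'. parfrac_span m p (Suc q) F' \<and> (\<forall>a b c. generic_triple a b c \<longrightarrow>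
    ((\<lambda>x. F a b x) has_real_derivative F' a b c) (at c))"
  using assms
proof induction
  case (pole_fst t u v)
  let ?F' = "\<lambda>a b c. of_rat (of_nat v) * (inverse a ^ t * inverse (a - b) ^ u * inverse (a - c) ^ Suc v)"
  have "parfrac_span m p (Suc q) ?F'"
    using pole_fst by (intro parfrac_span.scale parfrac_span.pole_fst) auto
  moreover have "generic_triple a b c \<Longrightarrow> ((\<lambda>x. inverse a ^ t * inverse (a - b) ^ u * inverse (a - x) ^ v)
      has_real_derivative ?F' a b c) (at c)" for a b c
    unfolding generic_triple_def
    by (rule DERIV_cong, (rule DERIV_mult DERIV_inverse_power DERIV_inverse_power_sub
          DERIV_inverse_power_sub' DERIV_const | simp (no_asm_simp))+)
      (simp add: of_rat_minus algebra_simps)?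
  ultimately show ?case by blast
next
  case (pole_snd t u v)
  let ?F' = "\<lambda>a b c. of_rat (of_nat v) * (inverse b ^ t * inverse (a - b) ^ u * inverse (b - c) ^ Suc v)"
  have "parfrac_span m p (Suc q) ?F'"
    using pole_snd by (intro parfrac_span.scale parfrac_span.pole_snd) auto
  moreover have "generic_triple a b c \<Longrightarrow> ((\<lambda>x. inverse b ^ t * inverse (a - b) ^ u * inverse (b - x) ^ v)
      has_real_derivative ?F' a b c) (at c)" for a b c
    unfolding generic_triple_def
    by (rule DERIV_cong, (rule DERIV_mult DERIV_inverse_power DERIV_inverse_power_sub
          DERIV_inverse_power_sub' DERIV_const | simp (no_asm_simp))+)
      (simp add: of_rat_minus algebra_simps)?
  ultimately show ?case by blast
next
  case (pole_trd t u v)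
  let ?F' = "\<lambda>a b c. of_rat (- of_nat t) * (inverse c ^ Suc t * inverse (b - c) ^ u * inverse (a - c) ^ v)
     + of_rat (of_nat u) * (inverse c ^ t * inverse (b - c) ^ Suc u * inverse (a - c) ^ v)
     + of_rat (of_nat v) * (inverse c ^ t * inverse (b - c) ^ u * inverse (a - c) ^ Suc v)"
  have "parfrac_span m p (Suc q) ?F'"
    using pole_trd by (intro parfrac_span_lincomb3 parfrac_span.pole_trd) auto
  moreover have "generic_triple a b c \<Longrightarrow> ((\<lambda>x. inverse x ^ t * inverse (b - x) ^ u * inverse (a - x) ^ v)
      has_real_derivative ?F' a b c) (at c)" for a b c
    unfolding generic_triple_def
    by (rule DERIV_cong, (rule DERIV_mult DERIV_inverse_power DERIV_inverse_power_sub
          DERIV_inverse_power_sub' DERIV_const | simp (no_asm_simp))+)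
      (simp add: of_rat_minus algebra_simps)?
  ultimately show ?case by blast
next
  case (add F G)
  then obtain F' G' where "parfrac_span m p (Suc q) F'" "parfrac_span m p (Suc q) G'"
    and "\<And>a b c. generic_triple a b c \<Longrightarrow> ((\<lambda>x. F a b x) has_real_derivative F' a b c) (at c)"
    and "\<And>a b c. generic_triple a b c \<Longrightarrow> ((\<lambda>x. G a b x) has_real_derivative G' a b c) (at c)"
    by blast
  then show ?case
    by (intro exI[of _ "\<lambda>a b c. F' a b c + G' a b c"]) (auto intro: parfrac_span.add DERIV_add)
next
  case (scale F r)
  then obtain F' where "parfrac_span m p (Suc q) F'"
    and "\<And>a b c. generic_triple a b c \<Longrightarrow> ((\<lambda>x. F a b x) has_real_derivative F' a b c) (at c)"
    by blast
  then show ?case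
    by (intro exI[of _ "\<lambda>a b c. of_rat r * F' a b c"]) (auto intro: parfrac_span.scale DERIV_cmult)
qed

text \<open>The expansion holds only off the exceptional points, so it is differentiated on an open
  set \<open>S\<close> avoiding them; dividing by -n normalises the next inverse power.\<close>

lemma DERIV_eq_inverse_power:
  fixes f :: "real \<Rightarrow> real"
  assumes "(f has_real_derivative D) (at x)" "open S" "x \<in> S" "x \<noteq> 0"
    and "\<And>y. y \<in> S \<Longrightarrow> f y = inverse y ^ n * K" and "n \<ge> 1"
  shows "of_rat (- inverse (of_nat n)) * D = inverse x ^ Suc n * K"
proof -
  have "((\<lambda>y. inverse y ^ n * K) has_real_derivative D) (at x)"
    using assms(1) by (rule DERIV_cong_ev[THEN iffD1, rotated 3, OF _ refl _ refl])
      (use assms(2,3,5) in \<open>auto simp: eventually_nhds\<close>)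
  moreover have "((\<lambda>y. inverse y ^ n * K) has_real_derivative - real n * inverse x ^ Suc n * K) (at x)"
    using DERIV_cmult_right[OF DERIV_inverse_power[OF \<open>x \<noteq> 0\<close>], of n K] by simp
  ultimately have "D = - real n * inverse x ^ Suc n * K" by (rule DERIV_unique)
  then show ?thesis using \<open>n \<ge> 1\<close> by (simp add: of_rat_minus of_rat_inverse)
qed

text \<open>The case \<open>m = p = q = 1\<close> is an explicit identity; differentiating in \<open>a\<close>, \<open>b\<close>, \<open>c\<close> raises
  the exponents and preserves the shape of the span.\<close>

lemma parfrac_exists:
  assumes "m \<ge> 1" "p \<ge> 1" "q \<ge> 1"
  shows "\<exists>F. parfrac_span m p q F \<and> (\<forall>a b c. generic_triple a b c \<longrightarrow>
    F a b c = inverse a ^ m * inverse b ^ p * inverse c ^ q)"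
proof -
  let ?P = "\<lambda>m p q. \<exists>F. parfrac_span m p q F \<and> (\<forall>a b c. generic_triple a b c \<longrightarrow>
    F a b c = inverse a ^ m * inverse b ^ p * inverse c ^ q)"
  have base: "?P 1 1 1"
  proof (intro exI conjI allI impI)
    show "parfrac_span 1 1 1 (\<lambda>a b c. of_rat 1 * (inverse a ^ 1 * inverse (a - b) ^ 1 * inverse (a - c) ^ 1)
      + of_rat (-1) * (inverse b ^ 1 * inverse (a - b) ^ 1 * inverse (b - c) ^ 1)
      + of_rat 1 * (inverse c ^ 1 * inverse (b - c) ^ 1 * inverse (a - c) ^ 1))"
      by (intro parfrac_span_lincomb3 parfrac_span.intros) auto
    fix a b c :: real
    assume "generic_triple a b c"
    then have nz: "a \<noteq> 0" "b \<noteq> 0" "c \<noteq> 0" "a - b \<noteq> 0" "b - c \<noteq> 0" "a - c \<noteq> 0"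
      by (auto simp: generic_triple_def)
    \<comment> \<open>Lagrange interpolation of the constant 1 at the nodes a, b, c, evaluated at 0
      and divided by abc; with denominators cleared it is the Vandermonde product.\<close>
    have "(a * b * c * (a - b) * (b - c) * (a - c)) * (1 / (a * (a - b) * (a - c)) - 1 / (b * (a - b) * (b - c)) + 1 / (c * (b - c) * (a - c)))
        = (a - b) * (b - c) * (a - c)"
      using nz by (simp add: divide_simps) (simp add: algebra_simps)
    also have "\<dots> = (a * b * c * (a - b) * (b - c) * (a - c)) * (1 / (a * b * c))"
      using nz by simp
    finally have "1 / (a * (a - b) * (a - c)) - 1 / (b * (a - b) * (b - c)) + 1 / (c * (b - c) * (a - c))
        = 1 / (a * b * c)"
      using nz by (subst (asm) mult_cancel_left) auto
    then show "of_rat 1 * (inverse a ^ 1 * inverse (a - b) ^ 1 * inverse (a - c) ^ 1)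
      + of_rat (-1) * (inverse b ^ 1 * inverse (a - b) ^ 1 * inverse (b - c) ^ 1)
      + of_rat 1 * (inverse c ^ 1 * inverse (b - c) ^ 1 * inverse (a - c) ^ 1)
      = inverse a ^ 1 * inverse b ^ 1 * inverse c ^ 1"
      by (simp add: divide_inverse of_rat_minus)
  qed
  have step1: "?P (Suc m) p q" if "?P m p q" "m \<ge> 1" for m p q
  proof -
    from that obtain F where F: "parfrac_span m p q F"
      "\<And>a b c. generic_triple a b c \<Longrightarrow> F a b c = inverse a ^ m * inverse b ^ p * inverse c ^ q" by blast
    from parfrac_span_DERIV_fst[OF F(1)] obtain F' where F': "parfrac_span (Suc m) p q F'"
      "\<And>a b c. generic_triple a b c \<Longrightarrow> ((\<lambda>x. F x b c) has_real_derivative F' a b c) (at a)" by blast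
    have "of_rat (- inverse (of_nat m)) * F' a b c = inverse a ^ Suc m * (inverse b ^ p * inverse c ^ q)"
      if g: "generic_triple a b c" for a b c
      by (rule DERIV_eq_inverse_power[where S = "- {0, b, c}" and f = "\<lambda>x. F x b c"])
        (use g F'(2) \<open>m \<ge> 1\<close> in \<open>auto simp: generic_triple_def F(2) intro: F'(2)\<close>)
    with parfrac_span.scale[OF F'(1), of "- inverse (of_nat m)"] show ?thesis
      by (intro exI conjI) (assumption, simp add: mult_ac)
  qed
  have step2: "?P m (Suc p) q" if "?P m p q" "p \<ge> 1" for m p q
  proof -
    from that obtain F where F: "parfrac_span m p q F"
      "\<And>a b c. generic_triple a b c \<Longrightarrow> F a b c = inverse a ^ m * inverse b ^ p * inverse c ^ q" by blast
    from parfrac_span_DERIV_snd[OF F(1)] obtain F' where F': "parfrac_span m (Suc p) q F'"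
      "\<And>a b c. generic_triple a b c \<Longrightarrow> ((\<lambda>x. F a x c) has_real_derivative F' a b c) (at b)" by blast
    have "of_rat (- inverse (of_nat p)) * F' a b c = inverse b ^ Suc p * (inverse a ^ m * inverse c ^ q)"
      if g: "generic_triple a b c" for a b c
      by (rule DERIV_eq_inverse_power[where S = "- {0, a, c}" and f = "\<lambda>x. F a x c"])
        (use g F'(2) \<open>p \<ge> 1\<close> in \<open>auto simp: generic_triple_def F(2) intro: F'(2)\<close>)
    with parfrac_span.scale[OF F'(1), of "- inverse (of_nat p)"] show ?thesis
      by (intro exI conjI) (assumption, simp add: mult_ac)
  qed
  have step3: "?P m p (Suc q)" if "?P m p q" "q \<ge> 1" for m p q
  proof -
    from that obtain F where F: "parfrac_span m p q F"
      "\<And>a b c. generic_triple a b c \<Longrightarrow> F a b c = inverse a ^ m * inverse b ^ p * inverse c ^ q" by blast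
    from parfrac_span_DERIV_trd[OF F(1)] obtain F' where F': "parfrac_span m p (Suc q) F'"
      "\<And>a b c. generic_triple a b c \<Longrightarrow> ((\<lambda>x. F a b x) has_real_derivative F' a b c) (at c)" by blast
    have "of_rat (- inverse (of_nat q)) * F' a b c = inverse c ^ Suc q * (inverse a ^ m * inverse b ^ p)"
      if g: "generic_triple a b c" for a b c
      by (rule DERIV_eq_inverse_power[where S = "- {0, a, b}" and f = "\<lambda>x. F a b x"])
        (use g F'(2) \<open>q \<ge> 1\<close> in \<open>auto simp: generic_triple_def F(2) intro: F'(2)\<close>)
    with parfrac_span.scale[OF F'(1), of "- inverse (of_nat q)"] show ?thesis
      by (intro exI conjI) (assumption, simp add: mult_ac)
  qed
  have "?P m 1 1" using \<open>m \<ge> 1\<close>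
    by (induction rule: dec_induct) (use base in blast, use step1 in blast)
  with \<open>p \<ge> 1\<close> have "?P m p 1"
    by (induction rule: dec_induct) (blast, use step2 in blast)
  with \<open>q \<ge> 1\<close> show ?thesis
    by (induction rule: dec_induct) (blast, use step3 in blast)
qed

section \<open>Tails and symmetric sums of correlations\<close>

text \<open>Abel summation: the boundary term is a tail of \<open>\<phi>\<close> times a partial sum
  of \<open>g\<close>, which the second assumption sends to 0. It exchanges two nested summations
  that need not converge absolutely.\<close>

lemma tail_swap:
  fixes \<phi> g :: "nat \<Rightarrow> real"
  assumes "summable \<phi>"
    and "(\<lambda>N. (\<Sum>n. \<phi> (n + N)) * (\<Sum>k<N. g k)) \<longlonglongrightarrow> 0"
    and "(\<lambda>k. g k * (\<Sum>n. \<phi> (n + k))) sums S"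
  shows "(\<lambda>n. \<phi> n * (\<Sum>k\<le>n. g k)) sums S"
proof -
  have tail: "(\<Sum>n. \<phi> (n + N)) = \<phi> N + (\<Sum>n. \<phi> (n + Suc N))" for N
    using suminf_split_head[of "\<lambda>n. \<phi> (n + N)"] summable_ignore_initial_segment[OF assms(1), of N]
    by simp
  have "(\<Sum>n<N. \<phi> n * (\<Sum>k\<le>n. g k)) =
      (\<Sum>k<N. g k * (\<Sum>n. \<phi> (n + k))) - (\<Sum>n. \<phi> (n + N)) * (\<Sum>k<N. g k)" for N
  proof (induction N)
    case (Suc N)
    have "(\<Sum>k\<le>N. g k) = (\<Sum>k<N. g k) + g N" by (simp add: lessThan_Suc_atMost[symmetric])
    then show ?case using Suc tail[of N] by (simp add: algebra_simps)
  qed simp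
  then show ?thesis
    using tendsto_diff[OF assms(3)[unfolded sums_def] assms(2)] by (simp add: sums_def)
qed

section \<open>Tails of signed reciprocal series\<close>

lemma inverse_square_telescope:
  fixes N :: nat
  shows "summable (\<lambda>n. 1 / (real (n + N) + 1) ^ 2)"
    and "(\<Sum>n. 1 / (real (n + N) + 1) ^ 2) \<le> 2 / (real N + 1)"
proof -
  \<comment> \<open>The factor 2 pays for bounding x(x+1) by 2x^2 when x is at least 1; it is the 2
    of the common tail bound 2/(N+1) below.\<close>
  let ?f = "\<lambda>n. 2 / (real (n + N) + 1)"
  have "?f \<longlonglongrightarrow> 0" by real_asymp
  then have s: "(\<lambda>n. ?f n - ?f (Suc n)) sums (2 / (real N + 1))"
    using telescope_sums'[of ?f 0] by simp
  have le: "1 / (real (n + N) + 1) ^ 2 \<le> ?f n - ?f (Suc n)" for n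
  proof -
    define x where "x = real (n + N) + 1"
    have x: "x \<ge> 1" by (simp add: x_def)
    have "1 / x ^ 2 \<le> 2 / x - 2 / (x + 1)"
    proof -
      have "2 / x - 2 / (x + 1) = 2 / (x * (x + 1))" using x by (simp add: divide_simps)
      moreover have "x * (x + 1) \<le> 2 * x ^ 2"
        using x mult_left_mono[of 1 x x] by (simp add: power2_eq_square algebra_simps)
      then have "1 / x ^ 2 \<le> 2 / (x * (x + 1))" using x by (simp add: divide_simps)
      ultimately show ?thesis by simp
    qed
    then show ?thesis by (simp add: x_def add_ac)
  qed
  show sm: "summable (\<lambda>n. 1 / (real (n + N) + 1) ^ 2)"
    using le by (intro summable_comparison_test'[OF sums_summable[OF s], of 0]) auto
  show "(\<Sum>n. 1 / (real (n + N) + 1) ^ 2) \<le> 2 / (real N + 1)"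
    using suminf_le[OF le sm sums_summable[OF s]] sums_unique[OF s] by simp
qed

lemma alternating_tail_le:
  fixes d :: "nat \<Rightarrow> real"
  assumes "d \<longlonglongrightarrow> 0" "\<And>n. 0 \<le> d n" "\<And>n. d (Suc n) \<le> d n"
  shows "summable (\<lambda>n. (-1) ^ n * d n)"
    and "\<bar>\<Sum>n. (-1) ^ (n + N) * d (n + N)\<bar> \<le> d N"
proof -
  show "summable (\<lambda>n. (-1) ^ n * d n)"
    using summable_Leibniz'(1)[OF assms] .
  let ?d = "\<lambda>n. d (n + N)"
  have d: "?d \<longlonglongrightarrow> 0" using assms(1) by (rule LIMSEQ_ignore_initial_segment)
  note L = summable_Leibniz'[of ?d, OF d assms(2)]
  have b: "0 \<le> (\<Sum>n. (-1) ^ n * ?d n)" "(\<Sum>n. (-1) ^ n * ?d n) \<le> d N"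
    using L(2)[of 0] L(4)[of 0] assms(3) by simp_all
  have "(\<Sum>n. (-1) ^ (n + N) * d (n + N)) = (-1) ^ N * (\<Sum>n. (-1) ^ n * ?d n)"
    using suminf_mult[of "\<lambda>n. (-1) ^ n * ?d n" "(-1) ^ N"] L(1) assms(3)
    by (simp add: power_add mult_ac)
  then show "\<bar>\<Sum>n. (-1) ^ (n + N) * d (n + N)\<bar> \<le> d N"
    using b by (simp add: abs_mult power_abs)
qed

text \<open>The two convergent cases have different causes: comparison with squares for s = 1, where
  r is at least 2, and Leibniz for s = -1. A common O(1/N) tail lets later arguments treat both
  alike.\<close>

lemma signed_series_tail:
  fixes d :: "nat \<Rightarrow> real" and s :: real
  assumes s: "s \<in> {1, -1}" and r: "r \<ge> 1" "(r, s) \<noteq> (1, 1)"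
    and d: "\<And>n. 0 \<le> d n" "\<And>n. d (Suc n) \<le> d n" "\<And>n. d n \<le> 1 / (real n + 1) ^ r"
  shows "summable (\<lambda>n. s ^ n * d n)"
    and "\<bar>\<Sum>n. s ^ (n + N) * d (n + N)\<bar> \<le> 2 / (real N + 1)"
proof -
  have d1: "d n \<le> 1 / (real n + 1)" for n
  proof -
    have "(real n + 1) ^ 1 \<le> (real n + 1) ^ r" using r by (intro power_increasing) auto
    then have "1 / (real n + 1) ^ r \<le> 1 / (real n + 1)" by (simp add: field_simps)
    then show ?thesis using d(3)[of n] by linarith
  qed
  have "summable (\<lambda>n. s ^ n * d n) \<and> \<bar>\<Sum>n. s ^ (n + N) * d (n + N)\<bar> \<le> 2 / (real N + 1)"
  proof (cases "s = 1")
    case True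
    then have r2: "r \<ge> 2" using r by (cases "r = 1") auto
    have d2: "d n \<le> 1 / (real n + 1) ^ 2" for n
    proof -
      have "(real n + 1) ^ 2 \<le> (real n + 1) ^ r" using r2 by (intro power_increasing) auto
      then have "1 / (real n + 1) ^ r \<le> 1 / (real n + 1) ^ 2" by (simp add: field_simps)
      then show ?thesis using d(3)[of n] by linarith
    qed
    have sm: "summable (\<lambda>n. d (n + M))" for M
      by (intro summable_comparison_test'[OF inverse_square_telescope(1)[of M], of 0])
        (use d(1) d2 in \<open>auto simp del: of_nat_add\<close>)
    have "(\<Sum>n. d (n + N)) \<le> (\<Sum>n. 1 / (real (n + N) + 1) ^ 2)"
      by (intro suminf_le d2 sm inverse_square_telescope)
    also have "\<dots> \<le> 2 / (real N + 1)" by (rule inverse_square_telescope)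
    finally have "(\<Sum>n. d (n + N)) \<le> 2 / (real N + 1)" .
    moreover have "0 \<le> (\<Sum>n. d (n + N))" by (intro suminf_nonneg sm d)
    ultimately show ?thesis using sm[of 0] True by simp
  next
    case False
    then have s: "s = -1" using s by simp
    have "(\<lambda>n. 1 / (real n + 1)) \<longlonglongrightarrow> 0" by real_asymp
    then have d0: "d \<longlonglongrightarrow> 0"
      by (rule Lim_null_comparison[rotated]) (use d1 d(1) in \<open>auto intro!: always_eventually\<close>)
    have "1 / (real N + 1) \<le> 2 / (real N + 1)" by (simp add: divide_right_mono)
    then have "d N \<le> 2 / (real N + 1)" using d1[of N] by linarith
    then show ?thesis unfolding s
      using alternating_tail_le[of d, OF d0 d(1,2)] by (blast intro: order_trans)
  qed
  then show "summable (\<lambda>n. s ^ n * d n)"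
    "\<bar>\<Sum>n. s ^ (n + N) * d (n + N)\<bar> \<le> 2 / (real N + 1)" by auto
qed

section \<open>Principal-value sums over the non-zero integers and correlations with odd
  reciprocals\<close>

definition sym_sum :: "(int \<Rightarrow> real) \<Rightarrow> nat \<Rightarrow> real" where
  "sym_sum V N = (\<Sum>y<N. V (int (Suc y)) + V (- int (Suc y)))"

lemma sym_sum_Suc: "sym_sum V (Suc N) = sym_sum V N + (V (int N + 1) + V (- 1 - int N))"
  by (simp add: sym_sum_def algebra_simps)

lemma sym_sum_add: "sym_sum (\<lambda>y. V y + W y) N = sym_sum V N + sym_sum W N"
  by (simp add: sym_sum_def sum.distrib algebra_simps)

lemma sym_sum_scale: "sym_sum (\<lambda>y. c * V y) N = c * sym_sum V N"
  by (simp add: sym_sum_def sum_distrib_left algebra_simps)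

text \<open>Any window lies in some [-M, M), and x -> -1-x, which preserves (2x+1)^2, folds that
  onto twice a one-sided sum. Uniformity in \<open>c\<close> matters because correlations are later
  taken at translates going to infinity.\<close>

lemma sum_inverse_square_shift_bounded:
  obtains B :: real where "\<And>c n. (\<Sum>i<n. 1 / (2 * of_int (c + int i) + 1) ^ 2) \<le> B"
proof -
  let ?q = "\<lambda>x::int. 1 / (2 * of_int x + 1) ^ 2 :: real"
  have sq: "summable (\<lambda>n. ?q (int n))"
    by (rule summable_comparison_test'[OF inverse_square_telescope(1)[of 0], of 0])
      (auto intro!: divide_left_mono power_mono)
  have "(\<Sum>i<n. ?q (c + int i)) \<le> 2 * (\<Sum>n. ?q (int n))" for c n
  proof -
    define M where "M = nat \<bar>c\<bar> + n"
    have "(\<Sum>i<n. ?q (c + int i)) = sum ?q ((\<lambda>i. c + int i) ` {..<n})"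
      by (subst sum.reindex) (auto intro: inj_onI)
    also have "\<dots> \<le> sum ?q {- int M..<int M}"
      by (intro sum_mono2) (auto simp: M_def)
    also have "{- int M..<int M} = int ` {..<M} \<union> (\<lambda>i. - 1 - int i) ` {..<M}"
    proof (intro set_eqI iffI)
      fix x assume x: "x \<in> {- int M..<int M}"
      show "x \<in> int ` {..<M} \<union> (\<lambda>i. - 1 - int i) ` {..<M}"
      proof (cases "x \<ge> 0")
        case True
        then show ?thesis using x by (intro UnI1 image_eqI[of _ _ "nat x"]) auto
      next
        case False
        then show ?thesis using x by (intro UnI2 image_eqI[of _ _ "nat (- 1 - x)"]) auto
      qed
    qed auto
    also have "sum ?q \<dots> = sum ?q (int ` {..<M}) + sum ?q ((\<lambda>i. - 1 - int i) ` {..<M})"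
      by (intro sum.union_disjoint) auto
    also have "sum ?q (int ` {..<M}) = (\<Sum>n<M. ?q (int n))"
      by (subst sum.reindex) (auto intro: inj_onI)
    also have "sum ?q ((\<lambda>i. - 1 - int i) ` {..<M}) = (\<Sum>n<M. ?q (- 1 - int n))"
      by (subst sum.reindex) (auto intro: inj_onI)
    also have "\<dots> = (\<Sum>n<M. ?q (int n))"
      by (intro sum.cong) (auto simp: power2_eq_square algebra_simps)
    also have "(\<Sum>n<M. ?q (int n)) + (\<Sum>n<M. ?q (int n)) \<le> 2 * (\<Sum>n. ?q (int n))"
      using sum_le_suminf[OF sq, of "{..<M}"] by simp
    finally show ?thesis .
  qed
  then show ?thesis by (rule that)
qed

text \<open>Weighted arithmetic-geometric mean: weight 1 gives absolute convergence of a product of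
  square-summable sequences, a small \<open>e\<close> makes the \<open>y\<close> part
  negligible.\<close>

lemma abs_mult_le_squares:
  fixes x y e :: real
  assumes "e > 0"
  shows "\<bar>x * y\<bar> \<le> x ^ 2 / e + e * y ^ 2"
proof -
  have "0 \<le> (\<bar>x\<bar> - e * \<bar>y\<bar>) ^ 2" by simp
  then have "2 * e * \<bar>x * y\<bar> \<le> x ^ 2 + e ^ 2 * y ^ 2"
    by (simp add: power2_eq_square algebra_simps abs_mult)
  moreover have "0 \<le> e * \<bar>x * y\<bar>" using assms by simp
  ultimately have "e * \<bar>x * y\<bar> \<le> x ^ 2 + e ^ 2 * y ^ 2" by linarith
  then show ?thesis using assms by (simp add: field_simps power2_eq_square)
qed

text \<open>The squares of \<open>h\<close> have sums bounded over all translates, so a late tail of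
  \<open>\<Gamma>\<close> contributes little uniformly in the translate, and only finitely many
  terms are left for the pointwise limit.\<close>

lemma square_summable_correlation:
  fixes \<Gamma> :: "nat \<Rightarrow> real" and h :: "int \<Rightarrow> real"
  assumes \<Gamma>: "summable (\<lambda>n. \<Gamma> n ^ 2)" and h: "\<And>x. \<bar>h x\<bar> \<le> 1 / \<bar>2 * of_int x + 1\<bar>"
  shows "summable (\<lambda>i. \<bar>\<Gamma> i * h (c + int i)\<bar>)"
    and "(\<And>i. (\<lambda>N. h (C N + int i)) \<longlonglongrightarrow> 0) \<Longrightarrow>
      (\<lambda>N::nat. \<Sum>i. \<Gamma> i * h (C N + int i)) \<longlonglongrightarrow> 0"
proof -
  obtain B :: real where B: "\<And>c n. (\<Sum>i<n. 1 / (2 * of_int (c + int i) + 1) ^ 2) \<le> B"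
    using sum_inverse_square_shift_bounded by blast
  have h2: "h x ^ 2 \<le> 1 / (2 * of_int x + 1) ^ 2" for x
    using power_mono[OF h[of x], of 2] by (simp add: power_divide)
  have hB: "(\<Sum>i<n. h (c + int i) ^ 2) \<le> B" for c n
    using B[of c n] sum_mono[of "{..<n}" "\<lambda>i. h (c + int i) ^ 2", OF h2] by (rule order_trans[rotated])
  have hs: "summable (\<lambda>i. h (c + int i) ^ 2)" for c
    by (intro bounded_imp_summable[of _ B]) (use hB[of c "Suc _"] in \<open>auto simp: lessThan_Suc_atMost\<close>)
  have hS: "(\<Sum>i. h (c + int i) ^ 2) \<le> B" for c
    by (intro suminf_le_const hs hB)
  show sm: "summable (\<lambda>i. \<bar>\<Gamma> i * h (c + int i)\<bar>)" for c
    using abs_mult_le_squares[of 1]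
    by (intro summable_comparison_test'[OF summable_add[OF \<Gamma> hs[of c]], of 0]) simp
  assume lim: "\<And>i. (\<lambda>N. h (C N + int i)) \<longlonglongrightarrow> 0"
  have B0: "B \<ge> 0" using hB[of 0 0] by simp
  show "(\<lambda>N. \<Sum>i. \<Gamma> i * h (C N + int i)) \<longlonglongrightarrow> 0"
  proof (rule LIMSEQ_I)
    fix e :: real
    assume "e > 0"
    \<comment> \<open>\<open>\<eta>\<close> makes the \<open>h\<close> part of the weighted bound at
      most e/4. The cut \<open>I\<close> is chosen after it, so that the tail of squares divided by
      \<open>\<eta>\<close> stays below e/4; the head below \<open>I\<close> gets the remaining
      e/2.\<close>
    define \<eta> where "\<eta> = e / (4 * (B + 1))"
    have \<eta>: "\<eta> > 0" "\<eta> * B \<le> e / 4" using B0 \<open>e > 0\<close> by (auto simp: \<eta>_def field_simps)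
    obtain I where I: "(\<Sum>i. \<Gamma> (i + I) ^ 2) < \<eta> * (e / 4)"
    proof -
      have "\<eta> * (e / 4) > 0" using \<eta> \<open>e > 0\<close> by simp
      from suminf_exist_split[OF this \<Gamma>] obtain I
        where "norm (\<Sum>i. \<Gamma> (i + I) ^ 2) < \<eta> * (e / 4)" by blast
      then show ?thesis by (intro that[of I]) (simp only: real_norm_def abs_less_iff)
    qed
    have tail: "\<bar>\<Sum>i. \<Gamma> (i + I) * h (c + int (i + I))\<bar> \<le> e / 2" for c
    proof -
      have s1: "summable (\<lambda>i. \<bar>\<Gamma> (i + I) * h (c + int (i + I))\<bar>)"
        by (rule summable_ignore_initial_segment[OF sm])
      have s2: "summable (\<lambda>i. \<Gamma> (i + I) ^ 2 / \<eta>)"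
        using summable_divide[OF summable_ignore_initial_segment[OF \<Gamma>, of I]] .
      have s3: "summable (\<lambda>i. \<eta> * h (c + int I + int i) ^ 2)"
        by (intro summable_mult hs)
      have pointwise: "\<bar>\<Gamma> (i + I) * h (c + int (i + I))\<bar> \<le>
          \<Gamma> (i + I) ^ 2 / \<eta> + \<eta> * h (c + int I + int i) ^ 2" for i
      proof -
        have "c + int (i + I) = c + int I + int i" by simp
        then show ?thesis using abs_mult_le_squares[OF \<eta>(1)] by (simp only:)
      qed
      have "\<bar>\<Sum>i. \<Gamma> (i + I) * h (c + int (i + I))\<bar> \<le> (\<Sum>i. \<bar>\<Gamma> (i + I) * h (c + int (i + I))\<bar>)"
        by (rule summable_rabs[OF s1])
      also have "\<dots> \<le> (\<Sum>i. \<Gamma> (i + I) ^ 2 / \<eta> + \<eta> * h (c + int I + int i) ^ 2)"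
        by (intro suminf_le s1 summable_add s2 s3 pointwise)
      also have "\<dots> = (\<Sum>i. \<Gamma> (i + I) ^ 2) / \<eta> + \<eta> * (\<Sum>i. h (c + int I + int i) ^ 2)"
        using suminf_add[OF s2 s3] suminf_mult[OF hs, of \<eta>]
          suminf_divide[OF summable_ignore_initial_segment[OF \<Gamma>, of I], of \<eta>] by simp
      also have "\<dots> \<le> e / 4 + \<eta> * B"
      proof (intro add_mono mult_left_mono hS)
        show "(\<Sum>i. \<Gamma> (i + I) ^ 2) / \<eta> \<le> e / 4" using I \<eta> by (simp add: field_simps)
      qed (use \<eta> in simp)
      finally show ?thesis using \<eta> by simp
    qed
    have "(\<lambda>N. \<Sum>i<I. \<Gamma> i * h (C N + int i)) \<longlonglongrightarrow> (\<Sum>i<I. \<Gamma> i * 0)"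
      by (intro tendsto_intros lim)
    then have "(\<lambda>N. \<Sum>i<I. \<Gamma> i * h (C N + int i)) \<longlonglongrightarrow> 0" by simp
    from LIMSEQ_D[OF this, of "e / 2"] \<open>e > 0\<close> obtain N0 where N0:
      "\<And>N. N \<ge> N0 \<Longrightarrow> \<bar>\<Sum>i<I. \<Gamma> i * h (C N + int i)\<bar> < e / 2" by auto
    show "\<exists>N0. \<forall>N\<ge>N0. norm ((\<Sum>i. \<Gamma> i * h (C N + int i)) - 0) < e"
    proof (intro exI[of _ N0] allI impI)
      fix N assume "N \<ge> N0"
      have "(\<Sum>i. \<Gamma> i * h (C N + int i)) = (\<Sum>i. \<Gamma> (i + I) * h (C N + int (i + I)))
          + (\<Sum>i<I. \<Gamma> i * h (C N + int i))"
        by (rule suminf_split_initial_segment[OF summable_rabs_cancel[OF sm]])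
      then show "norm ((\<Sum>i. \<Gamma> i * h (C N + int i)) - 0) < e"
        using tail[of "C N"] N0[OF \<open>N \<ge> N0\<close>] by simp
    qed
  qed
qed

lemma tendsto_odd_reciprocal_shift:
  assumes h: "\<And>x. \<bar>h x\<bar> \<le> 1 / \<bar>2 * real_of_int x + 1\<bar>"
  shows "(\<lambda>N. h (int N + c)) \<longlonglongrightarrow> 0" "(\<lambda>N. h (c - int N)) \<longlonglongrightarrow> 0"
proof -
  have 1: "(\<lambda>N. 1 / \<bar>2 * real_of_int (int N + c) + 1\<bar>) \<longlonglongrightarrow> 0"
    and 2: "(\<lambda>N. 1 / \<bar>2 * real_of_int (c - int N) + 1\<bar>) \<longlonglongrightarrow> 0"
    by simp_all real_asymp+
  show "(\<lambda>N. h (int N + c)) \<longlonglongrightarrow> 0"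
    by (rule Lim_null_comparison[OF _ 1]) (intro always_eventually allI, simp only: real_norm_def, rule h)
  show "(\<lambda>N. h (c - int N)) \<longlonglongrightarrow> 0"
    by (rule Lim_null_comparison[OF _ 2]) (intro always_eventually allI, simp only: real_norm_def, rule h)
qed

text \<open>Abel summation turns the window sums of the correlation \<open>V\<close> into a telescoping sum; what is
  left over pairs the square-summable tails of \<open>G\<close> with far translates of \<open>h\<close>.\<close>

lemma sym_sum_correlation:
  fixes G :: "nat \<Rightarrow> real" and h :: "int \<Rightarrow> real"
  assumes G: "summable G" and \<Gamma>: "summable (\<lambda>n. (\<Sum>i. G (i + n)) ^ 2)"
    and h: "\<And>x. \<bar>h x\<bar> \<le> 1 / \<bar>2 * of_int x + 1\<bar>"
    and w: "(\<lambda>N. h 0 + sym_sum h N) \<longlonglongrightarrow> w"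
  shows "summable (\<lambda>i. G i * h (y + int i))"
    and "sym_sum (\<lambda>y. \<Sum>i. G i * h (y + int i)) \<longlonglongrightarrow> suminf G * w - (\<Sum>i. G i * h (int i))"
proof -
  define \<Gamma>' where "\<Gamma>' = (\<lambda>n. \<Sum>i. G (i + n))"
  have \<Gamma>'2: "summable (\<lambda>n. \<Gamma>' n ^ 2)" "summable (\<lambda>n. \<Gamma>' (Suc n) ^ 2)"
    using \<Gamma> summable_ignore_initial_segment[OF \<Gamma>, of 1] by (simp_all add: \<Gamma>'_def)
  have G_eq: "G n = \<Gamma>' n - \<Gamma>' (Suc n)" for n
    using suminf_split_head[OF summable_ignore_initial_segment[OF G, of n]]
    unfolding \<Gamma>'_def by simp
  define P where "P = (\<lambda>y. \<Sum>i. \<Gamma>' (Suc i) * h (y + int i))"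
  have s1: "summable (\<lambda>i. \<Gamma>' i * h (y + int i))" for y
    by (rule summable_rabs_cancel[OF square_summable_correlation(1)[OF \<Gamma>'2(1) h]])
  have s2: "summable (\<lambda>i. \<Gamma>' (Suc i) * h (y + int i))" for y
    by (rule summable_rabs_cancel[OF square_summable_correlation(1)[OF \<Gamma>'2(2) h]])
  show "summable (\<lambda>i. G i * h (y + int i))" for y
    using summable_diff[OF s1[of y] s2[of y]] by (simp add: G_eq algebra_simps)
  define V where "V = (\<lambda>y. \<Sum>i. G i * h (y + int i))"
  have V: "V y = \<Gamma>' 0 * h y + P (y + 1) - P y" for y
  proof -
    have "V y = (\<Sum>i. \<Gamma>' i * h (y + int i)) - P y"
      unfolding V_def P_def using suminf_diff[OF s1[of y] s2[of y]] by (simp add: G_eq algebra_simps)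
    also have "(\<Sum>i. \<Gamma>' i * h (y + int i)) = \<Gamma>' 0 * h y + P (y + 1)"
      using suminf_split_head[OF s1[of y]] by (simp add: P_def algebra_simps)
    finally show ?thesis .
  qed
  have tel: "V 0 + sym_sum V N = \<Gamma>' 0 * (h 0 + sym_sum h N) + P (int N + 1) - P (0 - int N)" for N
  proof (induction N)
    case 0
    show ?case using V[of 0] by (simp add: sym_sum_def)
  next
    case (Suc N)
    have e: "- 1 - int N + 1 = 0 - int N" "0 - int (Suc N) = - 1 - int N"
      "int N + 1 + 1 = int (Suc N) + 1" by auto
    show ?case
      using Suc V[of "int N + 1"] V[of "- 1 - int N"]
      by (simp only: sym_sum_Suc e distrib_left)
  qed
  have P1: "(\<lambda>N. P (int N + 1)) \<longlonglongrightarrow> 0"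
    unfolding P_def using tendsto_odd_reciprocal_shift(1)[of h, OF h]
    by (intro square_summable_correlation(2)[OF \<Gamma>'2(2) h]) (simp add: add.assoc)
  have P2: "(\<lambda>N. P (0 - int N)) \<longlonglongrightarrow> 0"
    unfolding P_def using tendsto_odd_reciprocal_shift(2)[of h, OF h]
    by (intro square_summable_correlation(2)[OF \<Gamma>'2(2) h]) (simp add: algebra_simps)
  have "(\<lambda>N. V 0 + sym_sum V N) \<longlonglongrightarrow> \<Gamma>' 0 * w + 0 - 0"
    unfolding tel by (intro tendsto_intros w P1 P2)
  then have "(\<lambda>N. (V 0 + sym_sum V N) - V 0) \<longlonglongrightarrow> \<Gamma>' 0 * w + 0 - 0 - V 0"
    by (intro tendsto_intros)
  then show "sym_sum (\<lambda>y. \<Sum>i. G i * h (y + int i)) \<longlonglongrightarrow> suminf G * w - (\<Sum>i. G i * h (int i))"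
    by (simp add: V_def \<Gamma>'_def)
qed

text \<open>The exponent -7/4 is split as -9/8 - 5/8: the first part lies below -1 and sums the
  tail, the second leaves tails of order n^(-5/8), whose squares are summable. Any rate below -3/2
  admits such a split; -7/4 is -2 + 1/4, an inverse square times the fourth root that dominates a
  logarithm.\<close>

lemma square_summable_tails:
  fixes G :: "nat \<Rightarrow> real"
  assumes G: "\<And>i. \<bar>G i\<bar> \<le> C * (real i + 1) powr (- 7 / 4)"
  shows "summable (\<lambda>i. \<bar>G i\<bar>)" "summable (\<lambda>n. (\<Sum>i. G (i + n)) ^ 2)"
proof -
  have C: "C \<ge> 0" using G[of 0] by simp
  have pw: "summable (\<lambda>i. (real i + 1) powr e)" if "e < -1" for e
    using that summable_ignore_initial_segment[of "\<lambda>i. real i powr e" 1]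
    by (simp add: summable_real_powr_iff add.commute)
  show sG: "summable (\<lambda>i. \<bar>G i\<bar>)"
    by (rule summable_comparison_test'[OF summable_mult[OF pw[of "-7/4"], of C], of 0])
      (use G in auto)
  define S where "S = (\<Sum>i. C * (real i + 1) powr (- 9 / 8))"
  have sS: "summable (\<lambda>i. C * (real i + 1) powr (- 9 / 8))" by (intro summable_mult pw) simp
  have bound: "\<bar>\<Sum>i. G (i + n)\<bar> \<le> (real n + 1) powr (- 5 / 8) * S" for n
  proof -
    have sGn: "summable (\<lambda>i. \<bar>G (i + n)\<bar>)" by (rule summable_ignore_initial_segment[OF sG])
    have le: "\<bar>G (i + n)\<bar> \<le> (real n + 1) powr (- 5 / 8) * (C * (real i + 1) powr (- 9 / 8))" for i
    proof -
      have "(real (i + n) + 1) powr (- 7 / 4)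
          = (real (i + n) + 1) powr (- 5 / 8) * (real (i + n) + 1) powr (- 9 / 8)"
        by (simp add: powr_add[symmetric])
      also have "\<dots> \<le> (real n + 1) powr (- 5 / 8) * (real i + 1) powr (- 9 / 8)"
        by (intro mult_mono powr_mono2') auto
      finally have "C * (real (i + n) + 1) powr (- 7 / 4)
          \<le> C * ((real n + 1) powr (- 5 / 8) * (real i + 1) powr (- 9 / 8))"
        by (rule mult_left_mono[OF _ C])
      then show ?thesis using G[of "i + n"] by (simp add: mult_ac)
    qed
    have "\<bar>\<Sum>i. G (i + n)\<bar> \<le> (\<Sum>i. \<bar>G (i + n)\<bar>)" by (rule summable_rabs[OF sGn])
    also have "\<dots> \<le> (\<Sum>i. (real n + 1) powr (- 5 / 8) * (C * (real i + 1) powr (- 9 / 8)))"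
      by (intro suminf_le le sGn summable_mult sS)
    also have "\<dots> = (real n + 1) powr (- 5 / 8) * S"
      unfolding S_def by (rule suminf_mult[OF sS])
    finally show ?thesis .
  qed
  show "summable (\<lambda>n. (\<Sum>i. G (i + n)) ^ 2)"
  proof (rule summable_comparison_test'[OF summable_mult2[OF pw[of "-5/4"], of "S ^ 2"], of 0])
    fix n
    have "((\<Sum>i. G (i + n))) ^ 2 \<le> ((real n + 1) powr (- 5 / 8) * S) ^ 2"
      using power_mono[OF bound[of n], of 2] by simp
    also have "\<dots> = (real n + 1) powr (- 5 / 4) * S ^ 2"
      by (simp add: power_mult_distrib power2_eq_square powr_add[symmetric])
    finally show "norm ((\<Sum>i. G (i + n)) ^ 2) \<le> (real n + 1) powr (- 5 / 4) * S ^ 2" by simp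
  qed simp
qed

lemma inverse_square_le_powr:
  assumes "C \<ge> 0" "\<bar>x\<bar> \<le> C / (real i + 1) ^ 2"
  shows "\<bar>x\<bar> \<le> C * (real i + 1) powr (- 7 / 4)"
proof -
  have "C / (real i + 1) ^ 2 = C * (real i + 1) powr (- 2)"
    by (simp add: powr_minus divide_inverse)
  also have "\<dots> \<le> C * (real i + 1) powr (- 7 / 4)"
    using assms(1) by (intro mult_left_mono powr_mono) auto
  finally show ?thesis using assms(2) by linarith
qed

section \<open>Double sums over odd and even integers\<close>

abbreviation reducible :: "real \<Rightarrow> bool" where
  "reducible \<equiv>
     rational_polynomial_in (alt_zeta_values \<union> beta_values \<union> R_sum_values \<union> T_double_values)"

definition odd_term :: "real \<Rightarrow> nat \<Rightarrow> nat \<Rightarrow> real" where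
  "odd_term s r n = s ^ n / (2 * real n + 1) ^ r"

definition even_term :: "real \<Rightarrow> nat \<Rightarrow> nat \<Rightarrow> real" where
  "even_term s r n = s ^ n / (2 * real n + 2) ^ r"

lemma sign_of_int:
  fixes s :: real
  assumes "s \<in> {1, -1}"
  obtains \<sigma> :: int where "s = of_int \<sigma>" "\<sigma> \<in> {1, -1}" "\<And>r::nat. (r, s) \<noteq> (1, 1) \<Longrightarrow> (r, \<sigma>) \<noteq> (1, 1)"
proof (cases "s = 1")
  case True
  then show ?thesis by (intro that[of 1]) auto
next
  case False
  then show ?thesis using assms by (intro that[of "-1"]) auto
qed

lemma reducible_rat_multiple:
  assumes "x = c * y" "c \<in> \<rat>"
    and "y \<in> alt_zeta_values \<union> beta_values \<union> R_sum_values \<union> T_double_values"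
  shows "reducible x"
  unfolding assms(1) by (intro rational_polynomial_in_scale rational_polynomial_in_base assms)

lemma inverse_power_decreasing:
  fixes c :: real
  assumes "c \<ge> 1" "c \<le> 2"
  shows "1 / (2 * real (Suc n) + c) ^ r \<le> 1 / (2 * real n + c) ^ r"
    and "1 / (2 * real n + c) ^ r \<le> 1 / (real n + 1) ^ r"
  using assms by (auto intro!: divide_left_mono power_mono)

context
  fixes s :: real and r :: nat
  assumes s: "s \<in> {1, -1}" and r: "r \<ge> 1"
begin

lemma odd_term_abs_le: "\<bar>odd_term s r n\<bar> \<le> 1 / (real n + 1)"
proof -
  have "\<bar>s ^ n\<bar> = 1" using s by (auto simp: power_abs)
  then have "\<bar>odd_term s r n\<bar> = 1 / (2 * real n + 1) ^ r" by (simp add: odd_term_def abs_mult)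
  also have "\<dots> \<le> 1 / (real n + 1) ^ r" using inverse_power_decreasing(2)[of 1] by simp
  also have "(real n + 1) ^ 1 \<le> (real n + 1) ^ r" using r by (intro power_increasing) auto
  then have "1 / (real n + 1) ^ r \<le> 1 / (real n + 1)" by (simp add: field_simps)
  finally show ?thesis by simp
qed

lemma even_term_abs_le: "\<bar>even_term s r n\<bar> \<le> 1 / (real n + 1)"
proof -
  have "\<bar>s ^ n\<bar> = 1" using s by (auto simp: power_abs)
  then have "\<bar>even_term s r n\<bar> = 1 / (2 * real n + 2) ^ r" by (simp add: even_term_def abs_mult)
  also have "\<dots> \<le> 1 / (real n + 1) ^ r" using inverse_power_decreasing(2)[of 2] by simp
  also have "(real n + 1) ^ 1 \<le> (real n + 1) ^ r" using r by (intro power_increasing) auto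
  then have "1 / (real n + 1) ^ r \<le> 1 / (real n + 1)" by (simp add: field_simps)
  finally show ?thesis by simp
qed

context
  assumes rs: "(r, s) \<noteq> (1, 1)"
begin

lemma odd_term_tail:
  shows "summable (odd_term s r)" "\<bar>\<Sum>n. odd_term s r (n + N)\<bar> \<le> 2 / (real N + 1)"
  using signed_series_tail[of s r "\<lambda>n. 1 / (2 * real n + 1) ^ r", OF s r rs]
    inverse_power_decreasing[of 1]
  by (simp_all add: odd_term_def[abs_def])

lemma even_term_tail:
  shows "summable (even_term s r)" "\<bar>\<Sum>n. even_term s r (n + N)\<bar> \<le> 2 / (real N + 1)"
  using signed_series_tail[of s r "\<lambda>n. 1 / (2 * real n + 2) ^ r", OF s r rs]
    inverse_power_decreasing[of 2]
  by (simp_all add: even_term_def[abs_def])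

lemma reducible_even_sum: "reducible (suminf (even_term s r))"
proof -
  obtain \<sigma> :: int where \<sigma>: "s = of_int \<sigma>" "\<sigma> \<in> {1, -1}" "(r, \<sigma>) \<noteq> (1, 1)"
    using sign_of_int[OF s] rs by metis
  have ss: "s * s = 1" using s by auto
  have sc: "even_term s r n * (s * 2 ^ r) = of_int \<sigma> ^ Suc n / real (Suc n) ^ r" for n
  proof -
    have "(2 * real n + 2) ^ r = 2 ^ r * real (Suc n) ^ r"
      by (simp add: power_mult_distrib[symmetric] algebra_simps)
    then show ?thesis by (simp add: even_term_def \<sigma>(1))
  qed
  have "alt_zeta r \<sigma> = suminf (even_term s r) * (s * 2 ^ r)"
    unfolding alt_zeta_def using suminf_mult2[OF even_term_tail(1), of "s * 2 ^ r"] sc by simp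
  then have "suminf (even_term s r) = (s / 2 ^ r) * alt_zeta r \<sigma>"
    using ss by (simp add: mult.commute mult.left_commute)
  moreover have "s / 2 ^ r \<in> \<rat>" using \<sigma> by auto
  moreover have "alt_zeta r \<sigma> \<in> alt_zeta_values"
    using \<sigma> r by (auto simp: alt_zeta_values_def)
  ultimately show ?thesis by (intro reducible_rat_multiple) auto
qed

text \<open>For s = 1, grouping the zeta series in consecutive pairs gives odd + even = 2^r even, so
  the odd sum is 2^r - 1 times the even one. For s = -1 it is a beta value.\<close>

lemma reducible_odd_sum: "reducible (suminf (odd_term s r))"
proof (cases "s = 1")
  case True
  have f: "even_term 1 r n * 2 ^ r = 1 / real (Suc n) ^ r" for n
  proof -
    have "(2 * real n + 2) ^ r = 2 ^ r * real (Suc n) ^ r"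
      by (simp add: power_mult_distrib[symmetric] algebra_simps)
    then show ?thesis by (simp add: even_term_def)
  qed
  have sf: "(\<lambda>n. 1 / real (Suc n) ^ r) sums (suminf (even_term 1 r) * 2 ^ r)"
    using sums_mult2[OF summable_sums[OF even_term_tail(1)], of "2 ^ r"] True f by simp
  have "(\<lambda>n. \<Sum>i\<in>{n * 2..<n * 2 + 2}. 1 / real (Suc i) ^ r) sums (suminf (even_term 1 r) * 2 ^ r)"
    using sf by (rule sums_group) simp
  moreover have "(\<Sum>i\<in>{n * 2..<n * 2 + 2}. 1 / real (Suc i) ^ r) = odd_term 1 r n + even_term 1 r n" for n
  proof -
    have "{n * 2..<n * 2 + 2} = {n * 2, Suc (n * 2)}" by auto
    then show ?thesis by (simp add: odd_term_def even_term_def algebra_simps)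
  qed
  ultimately have "(\<lambda>n. odd_term 1 r n + even_term 1 r n) sums (suminf (even_term 1 r) * 2 ^ r)"
    by simp
  moreover have "(\<lambda>n. odd_term 1 r n + even_term 1 r n) sums
      (suminf (odd_term 1 r) + suminf (even_term 1 r))"
    using odd_term_tail(1) even_term_tail(1) True by (intro sums_add summable_sums) auto
  ultimately have "suminf (odd_term 1 r) = suminf (even_term 1 r) * 2 ^ r - suminf (even_term 1 r)"
    using sums_unique2 by fastforce
  also have "\<dots> = (2 ^ r - 1) * suminf (even_term 1 r)" by (simp add: algebra_simps)
  finally show ?thesis using True reducible_even_sum
    by (simp add: rational_polynomial_in_scale)
next
  case False
  then have "s = -1" using s by simp
  then have "suminf (odd_term s r) = dirichlet_beta r"
    by (simp add: dirichlet_beta_def odd_term_def[abs_def] algebra_simps)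
  moreover have "dirichlet_beta r \<in> beta_values" using r by (auto simp: beta_values_def)
  ultimately show ?thesis by (simp add: rational_polynomial_in_base)
qed

end
end

section \<open>Logarithmic growth of partial sums against decay of tails\<close>

lemma harm_le_powr: "(harm n :: real) \<le> 5 * (real n + 1) powr (1 / 4)"
proof (cases n)
  case 0
  then show ?thesis by (simp add: harm_def)
next
  case (Suc k)
  have "harm (Suc k) - ln (real (Suc k)) \<le> harm (Suc 0) - ln (real (Suc 0))"
    using decseqD[OF decseq_harm_diff_ln, of 0 k] by simp
  then have "harm n \<le> 1 + ln (real n)" using Suc by (simp add: harm_def)
  moreover have "ln (real n) \<le> 4 * real n powr (1 / 4)"
    using Suc ln_powr_bound[of "real n" "1 / 4"] by simp
  moreover have "real n powr (1 / 4) \<le> (real n + 1) powr (1 / 4)" by (intro powr_mono2) auto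
  moreover have "1 \<le> (real n + 1) powr (1 / 4)" by (intro ge_one_powr_ge_zero) auto
  ultimately show ?thesis by linarith
qed

lemma sum_abs_le_powr:
  fixes g :: "nat \<Rightarrow> real"
  assumes "\<And>k. \<bar>g k\<bar> \<le> 1 / (real k + 1)"
  shows "\<bar>\<Sum>k<N. g k\<bar> \<le> 5 * (real N + 1) powr (1 / 4)"
proof -
  have "\<bar>\<Sum>k<N. g k\<bar> \<le> (\<Sum>k<N. 1 / (real k + 1))"
    using assms by (intro order_trans[OF sum_abs] sum_mono)
  also have "\<dots> = harm N" by (simp add: harm_altdef divide_inverse add.commute)
  finally show ?thesis using harm_le_powr[of N] by linarith
qed

text \<open>The boundary term of Abel summation: a tail of order 1/N beats partial sums of at most
  logarithmic growth, even when the series of \<open>g\<close> diverges.\<close>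

lemma tail_times_partial_sum_tendsto_0:
  fixes g \<Phi> :: "nat \<Rightarrow> real"
  assumes "\<And>N. \<bar>\<Phi> N\<bar> \<le> 2 / (real N + 1)" "\<And>k. \<bar>g k\<bar> \<le> 1 / (real k + 1)"
  shows "(\<lambda>N. \<Phi> N * (\<Sum>k<N. g k)) \<longlonglongrightarrow> 0"
proof (rule Lim_null_comparison)
  show "(\<lambda>N. 2 / (real N + 1) * (5 * (real N + 1) powr (1 / 4))) \<longlonglongrightarrow> 0" by real_asymp
  show "\<forall>\<^sub>F N in sequentially. norm (\<Phi> N * (\<Sum>k<N. g k)) \<le> 2 / (real N + 1) * (5 * (real N + 1) powr (1 / 4))"
    unfolding real_norm_def abs_mult
    by (intro always_eventually allI mult_mono assms(1) sum_abs_le_powr[OF assms(2)]) auto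
qed

text \<open>A term times a tail is O(1/k^2) although the nested sum may converge only conditionally.
  Passing to \<open>G\<close> thus gains absolute convergence, and square-summable tails with
  it.\<close>

lemma weighted_tails:
  fixes g \<phi> :: "nat \<Rightarrow> real"
  assumes \<phi>: "summable \<phi>" "\<And>N. \<bar>\<Sum>n. \<phi> (n + N)\<bar> \<le> 2 / (real N + 1)"
    and g: "\<And>k. \<bar>g k\<bar> \<le> 1 / (real k + 1)"
  defines "G \<equiv> \<lambda>k. g k * (\<Sum>n. \<phi> (n + k))"
  shows "summable (\<lambda>k. \<bar>G k\<bar>)" "summable (\<lambda>n. (\<Sum>i. G (i + n)) ^ 2)"
    and "(\<lambda>n. \<phi> n * (\<Sum>k\<le>n. g k)) sums suminf G"
proof -
  have "\<bar>G k\<bar> \<le> 1 / (real k + 1) * (2 / (real k + 1))" for k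
    unfolding G_def abs_mult by (intro mult_mono \<phi> g) auto
  then have G: "\<bar>G k\<bar> \<le> 2 * (real k + 1) powr (- 7 / 4)" for k
    by (intro inverse_square_le_powr) (auto simp: power2_eq_square)
  show sm: "summable (\<lambda>k. \<bar>G k\<bar>)" "summable (\<lambda>n. (\<Sum>i. G (i + n)) ^ 2)"
    using square_summable_tails[OF G] by auto
  show "(\<lambda>n. \<phi> n * (\<Sum>k\<le>n. g k)) sums suminf G"
    using summable_sums[OF summable_rabs_cancel[OF sm(1)]]
    by (intro tail_swap \<phi>(1) tail_times_partial_sum_tendsto_0 \<phi>(2) g) (simp add: G_def)
qed

section \<open>Translation of nested sums into double T-values and R-sums\<close>

lemma T_double_eq:
  fixes \<sigma>1 \<sigma>2 :: int
  assumes "(\<lambda>n. even_term (of_int \<sigma>1) p n * (\<Sum>k\<le>n. odd_term (of_int \<sigma>2) q k)) sums x"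
    and \<sigma>: "\<sigma>1 \<in> {1, -1}" "\<sigma>2 \<in> {1, -1}"
  shows "T_double p q \<sigma>1 \<sigma>2 = 4 * of_int \<sigma>2 * x"
proof -
  let ?f = "\<lambda>n1. \<Sum>n2\<in>{1..<n1}. of_int \<sigma>1 ^ n1 * of_int \<sigma>2 ^ n2 /
            ((2 * real n1 - 2) ^ p * (2 * real n2 - 1) ^ q) :: real"
  have 1: "(of_int \<sigma>1 :: real) * of_int \<sigma>1 = 1" using \<sigma> by auto
  \<comment> \<open>The outer indices 0 and 1 have empty inner sums. The shift n1 = n + 2 leaves the
    power of \<open>\<sigma>1\<close> unchanged, while n2 = k + 1 produces the factor
    \<open>\<sigma>2\<close>.\<close>
  have "?f (n + 2) = of_int \<sigma>2 * (even_term (of_int \<sigma>1) p n * (\<Sum>k\<le>n. odd_term (of_int \<sigma>2) q k))" for n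
  proof -
    have "?f (n + 2) = (\<Sum>k\<in>{0..<Suc n}. of_int \<sigma>1 ^ (n + 2) * of_int \<sigma>2 ^ Suc k /
            ((2 * real (n + 2) - 2) ^ p * (2 * real (Suc k) - 1) ^ q))"
      by (rule sum.reindex_bij_witness[of _ Suc "\<lambda>k. k - 1"]) auto
    also have "\<dots> = (\<Sum>k\<le>n. of_int \<sigma>2 * (even_term (of_int \<sigma>1) p n * odd_term (of_int \<sigma>2) q k))"
    proof (intro sum.cong)
      fix k
      have e: "(of_int \<sigma>1 :: real) ^ (n + 2) = of_int \<sigma>1 ^ n"
        "2 * real (n + 2) - 2 = 2 * real n + 2" "2 * real (Suc k) - 1 = 2 * real k + 1"
        using 1 by (simp_all add: power_add power2_eq_square)
      show "of_int \<sigma>1 ^ (n + 2) * of_int \<sigma>2 ^ Suc k /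
            ((2 * real (n + 2) - 2) ^ p * (2 * real (Suc k) - 1) ^ q) =
          of_int \<sigma>2 * (even_term (of_int \<sigma>1) p n * odd_term (of_int \<sigma>2) q k)"
        unfolding e by (simp add: even_term_def odd_term_def)
    qed auto
    finally show ?thesis by (simp add: sum_distrib_left)
  qed
  then have "(\<lambda>n. ?f (n + 2)) sums (of_int \<sigma>2 * x)" using sums_mult[OF assms(1)] by simp
  moreover have "(\<Sum>i<2. ?f i) = 0" by (simp add: numeral_2_eq_2)
  ultimately have "?f sums (of_int \<sigma>2 * x)"
    using sums_iff_shift[of ?f 2 "of_int \<sigma>2 * x"] by simp
  then show ?thesis by (simp add: T_double_def sums_iff)
qed

lemma R_sum_eq:
  assumes "(\<lambda>n. odd_term (of_int \<sigma>2) q n * (\<Sum>k<n. even_term (of_int \<sigma>1) p k)) sums x"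
  shows "R_sum p q \<sigma>1 \<sigma>2 = 2 ^ (p + q) * x"
proof -
  have eq: "of_int \<sigma>2 ^ n * alt_harmonic n p \<sigma>1 / (real (Suc n) - 1 / 2) ^ q =
      2 ^ (p + q) * (odd_term (of_int \<sigma>2) q n * (\<Sum>k<n. even_term (of_int \<sigma>1) p k))" for n
  proof -
    have "(2 * real n + 1) ^ q = 2 ^ q * (real (Suc n) - 1 / 2) ^ q"
      by (simp add: power_mult_distrib[symmetric] algebra_simps)
    then have 1: "of_int \<sigma>2 ^ n / (real (Suc n) - 1 / 2) ^ q = 2 ^ q * odd_term (of_int \<sigma>2) q n"
      by (simp add: odd_term_def)
    have "alt_harmonic n p \<sigma>1 = (\<Sum>k<n. of_int \<sigma>1 ^ k / real (Suc k) ^ p)"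
      unfolding alt_harmonic_def
      by (rule sum.reindex_bij_witness[of _ Suc "\<lambda>k. k - 1"]) auto
    also have "\<dots> = (\<Sum>k<n. 2 ^ p * even_term (of_int \<sigma>1) p k)"
    proof (intro sum.cong refl)
      fix k
      have "(2 * real k + 2) ^ p = 2 ^ p * real (Suc k) ^ p"
        by (simp add: power_mult_distrib[symmetric] algebra_simps)
      then show "of_int \<sigma>1 ^ k / real (Suc k) ^ p = 2 ^ p * even_term (of_int \<sigma>1) p k"
        by (simp add: even_term_def)
    qed
    finally have 2: "alt_harmonic n p \<sigma>1 = 2 ^ p * (\<Sum>k<n. even_term (of_int \<sigma>1) p k)"
      by (simp add: sum_distrib_left)
    have "of_int \<sigma>2 ^ n * alt_harmonic n p \<sigma>1 / (real (Suc n) - 1 / 2) ^ q =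
        (of_int \<sigma>2 ^ n / (real (Suc n) - 1 / 2) ^ q) * alt_harmonic n p \<sigma>1" by simp
    then show ?thesis unfolding 1 2 by (simp add: power_add)
  qed
  show ?thesis unfolding R_sum_def eq using sums_mult[OF assms, of "2 ^ (p + q)"] by (simp add: sums_iff)
qed

text \<open>With the even denominator outside, \<open>k \<le> n\<close> says 2k+1 < 2n+2, the
  ordering of a double T-value. The inner series may diverge.\<close>

lemma reducible_even_odd:
  assumes s: "s \<in> {1, -1}" "s' \<in> {1, -1}" and "r \<ge> 1" "u \<ge> 1" "(r, s) \<noteq> (1, 1)"
    and x: "(\<lambda>n. even_term s r n * (\<Sum>k\<le>n. odd_term s' u k)) sums x"
  shows "reducible x"
proof -
  obtain \<sigma> :: int where \<sigma>: "s = of_int \<sigma>" "\<sigma> \<in> {1, -1}" "(r, \<sigma>) \<noteq> (1, 1)"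
    using sign_of_int[OF s(1)] assms by metis
  obtain \<sigma>' :: int where \<sigma>': "s' = of_int \<sigma>'" "\<sigma>' \<in> {1, -1}" using sign_of_int[OF s(2)] by metis
  have "T_double r u \<sigma> \<sigma>' = 4 * s' * x"
    using T_double_eq[of \<sigma> r \<sigma>' u x] x \<sigma> \<sigma>' by simp
  then have "x = (s' / 4) * T_double r u \<sigma> \<sigma>'" using s(2) by auto
  moreover have "s' / 4 \<in> \<rat>" using \<sigma>' by auto
  moreover have "T_double r u \<sigma> \<sigma>' \<in> T_double_values"
    using \<sigma> \<sigma>' assms by (auto simp: T_double_values_def)
  ultimately show ?thesis by (intro reducible_rat_multiple) auto
qed

text \<open>With the odd denominator outside, 2k+2 < 2n+1 becomes the strict \<open>k < n\<close>,
  the ordering of an R-sum; the power of 2 rescales its denominators to odd and even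
  integers.\<close>

lemma reducible_odd_even:
  assumes s: "s \<in> {1, -1}" "s' \<in> {1, -1}" and "r \<ge> 1" "u \<ge> 1" "(r, s) \<noteq> (1, 1)"
    and x: "(\<lambda>n. odd_term s r n * (\<Sum>k<n. even_term s' u k)) sums x"
  shows "reducible x"
proof -
  obtain \<sigma> :: int where \<sigma>: "s = of_int \<sigma>" "\<sigma> \<in> {1, -1}" "(r, \<sigma>) \<noteq> (1, 1)"
    using sign_of_int[OF s(1)] assms by metis
  obtain \<sigma>' :: int where \<sigma>': "s' = of_int \<sigma>'" "\<sigma>' \<in> {1, -1}" using sign_of_int[OF s(2)] by metis
  have "R_sum u r \<sigma>' \<sigma> = 2 ^ (u + r) * x"
    using R_sum_eq[of \<sigma> r \<sigma>' u x] x \<sigma> \<sigma>' by simp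
  then have "x = (1 / 2 ^ (u + r)) * R_sum u r \<sigma>' \<sigma>" by simp
  moreover have "1 / 2 ^ (u + r) \<in> (\<rat> :: real set)" by simp
  moreover have "R_sum u r \<sigma>' \<sigma> \<in> R_sum_values"
    using \<sigma> \<sigma>' assms by (auto simp: R_sum_values_def)
  ultimately show ?thesis by (intro reducible_rat_multiple[of x "1 / 2 ^ (u + r)" "R_sum u r \<sigma>' \<sigma>"]) auto
qed

text \<open>Collects what the correlation argument asks of a weight: summability, square-summable
  tails and a reducible total. The total is a double T-value with its two summations exchanged, up
  to a rational factor.\<close>

lemma odd_times_even_tails:
  assumes s: "s \<in> {1, -1}" "s' \<in> {1, -1}" and r: "r \<ge> 1" "u \<ge> 1" "(r, s) \<noteq> (1, 1)"
  defines "G \<equiv> \<lambda>k. odd_term s' u k * (\<Sum>n. even_term s r (n + k))"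
  shows "summable G" "summable (\<lambda>n. (\<Sum>i. G (i + n)) ^ 2)" "reducible (suminf G)"
    and "(\<lambda>n. even_term s r n * (\<Sum>k\<le>n. odd_term s' u k)) sums suminf G"
proof -
  note w = weighted_tails[of "even_term s r" "odd_term s' u", OF even_term_tail(1)[OF s(1) r(1,3)]
      even_term_tail(2)[OF s(1) r(1,3)] odd_term_abs_le[OF s(2) r(2)]]
  show "summable G" using summable_rabs_cancel[OF w(1)] by (simp add: G_def)
  show "summable (\<lambda>n. (\<Sum>i. G (i + n)) ^ 2)"
    using w(2) by (simp add: G_def)
  show *: "(\<lambda>n. even_term s r n * (\<Sum>k\<le>n. odd_term s' u k)) sums suminf G"
    using w(3) by (simp add: G_def)
  show "reducible (suminf G)" by (rule reducible_even_odd[OF s r *])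
qed

text \<open>The tail starts at \<open>Suc k\<close> because the odd numbers above 2k+2 begin with
  2k+3. In nested form the term n = 0 is empty, so the general tail lemma is applied to the sequence
  shifted by one.\<close>

lemma even_times_odd_tails:
  assumes s: "s \<in> {1, -1}" "s' \<in> {1, -1}" and r: "r \<ge> 1" "u \<ge> 1" "(r, s) \<noteq> (1, 1)"
  defines "G \<equiv> \<lambda>k. even_term s' u k * (\<Sum>n. odd_term s r (n + Suc k))"
  shows "summable G" "reducible (suminf G)"
proof -
  have b: "\<bar>\<Sum>n. odd_term s r (Suc (n + N))\<bar> \<le> 2 / (real N + 1)" for N
  proof -
    have "2 / (real (Suc N) + 1) \<le> 2 / (real N + 1)" by (intro divide_left_mono) auto
    then show ?thesis using odd_term_tail(2)[OF s(1) r(1,3), of "Suc N"] by simp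
  qed
  have sm: "summable (\<lambda>n. odd_term s r (Suc n))"
    using odd_term_tail(1)[OF s(1) r(1,3)] summable_Suc_iff by blast
  have G': "(\<lambda>k. even_term s' u k * (\<Sum>n. odd_term s r (Suc (n + k)))) = G"
    by (simp add: G_def)
  note w = weighted_tails[of "\<lambda>n. odd_term s r (Suc n)" "even_term s' u", OF sm b
      even_term_abs_le[OF s(2) r(2)], unfolded G']
  show "summable G" using summable_rabs_cancel[OF w(1)] by (simp add: G_def)
  have "(\<lambda>n. odd_term s r n * (\<Sum>k<n. even_term s' u k)) sums suminf G"
    by (rule sums_Suc_imp) (use w(3) in \<open>simp_all add: lessThan_Suc_atMost\<close>)
  then show "reducible (suminf G)" by (rule reducible_odd_even[OF s r])
qed

section \<open>Integer-indexed terms and harmonic regularisation\<close>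

definition odd_int :: "real \<Rightarrow> nat \<Rightarrow> int \<Rightarrow> real" where
  "odd_int s r x = s powi x / (2 * of_int x + 1) ^ r"

lemma sign_powi:
  fixes s :: real
  assumes "s \<in> {1, -1}"
  shows "s powi (x + y) = s powi x * s powi y" "s powi (x - y) = s powi x * s powi y"
    "s powi (- x) = s powi x" "\<bar>s powi x\<bar> = 1" "s powi x * s powi x = 1"
  using assms by (auto simp: power_int_minus_left)

lemma odd_int_of_nat: "odd_int s r (int n) = odd_term s r n"
  by (simp add: odd_int_def odd_term_def)

lemma odd_int_reflect:
  assumes "s \<in> {1, -1}"
  shows "odd_int s r (- 1 - x) = s * (-1) ^ r * odd_int s r x"
proof -
  have "s powi (- 1 - x) = s * s powi x"
    using sign_powi(2)[OF assms, of "-1" x] sign_powi(3)[OF assms, of 1] by simp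
  moreover have "2 * real_of_int (- 1 - x) + 1 = (-1) * (2 * of_int x + 1)" by simp
  then have "(2 * real_of_int (- 1 - x) + 1) ^ r = (-1) ^ r * (2 * of_int x + 1) ^ r"
    by (simp only: power_mult_distrib)
  moreover have "(-1 :: real) ^ r * (-1) ^ r = 1" by (simp add: power_mult_distrib[symmetric])
  ultimately show ?thesis
    by (simp add: odd_int_def divide_simps)
qed

lemma odd_int_abs_le:
  assumes "s \<in> {1, -1}" "r \<ge> 1"
  shows "\<bar>odd_int s r x\<bar> \<le> 1 / \<bar>2 * of_int x + 1\<bar>"
proof -
  have "\<bar>2 * x + 1\<bar> \<ge> 1" by presburger
  then have ge: "\<bar>2 * real_of_int x + 1\<bar> \<ge> 1" by linarith
  then have "\<bar>2 * real_of_int x + 1\<bar> ^ 1 \<le> \<bar>2 * real_of_int x + 1\<bar> ^ r"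
    using assms(2) by (intro power_increasing) auto
  then have "1 / \<bar>2 * real_of_int x + 1\<bar> ^ r \<le> 1 / \<bar>2 * real_of_int x + 1\<bar>"
    using ge by (intro divide_left_mono) auto
  then show ?thesis using sign_powi(4)[OF assms(1)] by (simp add: odd_int_def abs_divide power_abs)
qed

text \<open>The window from -N to N consists of the pairs n, -1-n with n < N and the unpaired index
  N, whose term vanishes in the limit. In the divergent case the pair factor
  \<open>1 + s * (-1) ^ r\<close> is 0, so the principal value exists there too.\<close>

lemma odd_int_window:
  assumes s: "s \<in> {1, -1}" and r: "r \<ge> 1"
  obtains w where "reducible w" "(\<lambda>N. odd_int s r 0 + sym_sum (odd_int s r) N) \<longlonglongrightarrow> w"
proof -
  have eq: "odd_int s r 0 + sym_sum (odd_int s r) N =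
      odd_int s r (int N + 0) + (1 + s * (-1) ^ r) * (\<Sum>n<N. odd_term s r n)" for N
  proof (induction N)
    case 0
    show ?case by (simp add: sym_sum_def)
  next
    case (Suc N)
    have "int N + 1 = int (Suc N)" by simp
    then show ?case
      using Suc odd_int_reflect[OF s, of r "int N"] odd_int_of_nat[of s r N]
      by (simp add: sym_sum_Suc algebra_simps)
  qed
  have lim: "(\<lambda>N. odd_int s r (int N + 0)) \<longlonglongrightarrow> 0"
    by (rule tendsto_odd_reciprocal_shift(1)[of "odd_int s r", OF odd_int_abs_le[OF s r]])
  show ?thesis
  proof (cases "(r, s) = (1, 1)")
    case True
    then have "1 + s * (- 1) ^ r = 0" by simp
    then show ?thesis using lim rational_polynomial_in_Rats[of 0]
      by (intro that[of 0]) (simp_all only: eq, simp_all)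
  next
    case False
    have "(\<lambda>N. odd_int s r 0 + sym_sum (odd_int s r) N) \<longlonglongrightarrow>
        0 + (1 + s * (-1) ^ r) * suminf (odd_term s r)"
      unfolding eq using summable_LIMSEQ[OF odd_term_tail(1)[OF s r False]]
      by (intro tendsto_intros lim)
    moreover have "s \<in> \<rat>" using s by auto
    then have "1 + s * (-1) ^ r \<in> \<rat>" by simp
    then have "reducible ((1 + s * (-1) ^ r) * suminf (odd_term s r))"
      by (intro rational_polynomial_in_scale reducible_odd_sum[OF s r False])
    ultimately show ?thesis by (intro that) auto
  qed
qed

text \<open>The functions \<open>odd_sum\<close> and \<open>even_tail\<close> are the limits of the partial sums minus
  \<open>divergent_part\<close>, which vanishes unless the series is the divergent one.\<close>

definition divergent_part :: "nat \<Rightarrow> real \<Rightarrow> nat \<Rightarrow> real" where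
  "divergent_part r s L = (if (r, s) = (1, 1) then \<Sum>j<L. odd_term 1 1 j else 0)"

definition odd_sum :: "real \<Rightarrow> nat \<Rightarrow> real" where
  "odd_sum s r = (if (r, s) = (1, 1) then 0 else suminf (odd_term s r))"

definition even_tail :: "real \<Rightarrow> nat \<Rightarrow> nat \<Rightarrow> real" where
  "even_tail s r k = (if (r, s) = (1, 1) then alt_zeta 1 (-1) - (\<Sum>j<k. even_term 1 1 j)
     else \<Sum>n. even_term s r (n + k))"

lemma divergent_part_at_top: "filterlim (divergent_part 1 1) at_top sequentially"
proof (rule filterlim_at_top_mono)
  show "filterlim (\<lambda>L. 1 / 2 * harm L :: real) at_top sequentially"
    using harm_at_top by (intro filterlim_tendsto_pos_mult_at_top[OF tendsto_const]) auto
  have "1 / 2 * harm L \<le> divergent_part 1 1 L" for L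
    unfolding divergent_part_def harm_altdef sum_distrib_left
    by (auto intro!: sum_mono simp: odd_term_def field_simps)
  then show "\<forall>\<^sub>F L in sequentially. 1 / 2 * harm L \<le> divergent_part 1 1 L" by simp
qed

lemma odd_sum_tendsto:
  assumes "s \<in> {1, -1}" "r \<ge> 1"
  shows "(\<lambda>L. (\<Sum>j<L. odd_term s r j) - divergent_part r s L) \<longlonglongrightarrow> odd_sum s r"
  using summable_LIMSEQ[OF odd_term_tail(1)[OF assms]]
  by (auto simp: odd_sum_def divergent_part_def)

lemma reducible_odd_sum':
  assumes "s \<in> {1, -1}" "r \<ge> 1"
  shows "reducible (odd_sum s r)"
  using reducible_odd_sum[OF assms] rational_polynomial_in_of_rat[of _ 0]
  by (auto simp: odd_sum_def)

text \<open>Consecutive pairs of -1 + 1/2 - 1/3 + ... are grouped. This constant lets odd and even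
  harmonic sums share one divergent part.\<close>

lemma even_minus_odd_sums: "(\<lambda>n. even_term 1 1 n - odd_term 1 1 n) sums alt_zeta 1 (-1)"
proof -
  let ?f = "\<lambda>n. - ((-1) ^ n * (1 / real (Suc n))) :: real"
  have "(\<lambda>n. 1 / real (Suc n)) \<longlonglongrightarrow> 0" by real_asymp
  then have "summable (\<lambda>n. (-1) ^ n * (1 / real (Suc n)) :: real)"
    by (rule alternating_tail_le) (auto simp: field_simps)
  then have "?f sums (\<Sum>n. ?f n)" by (intro summable_sums summable_minus)
  also have "(\<Sum>n. ?f n) = alt_zeta 1 (-1)" by (simp add: alt_zeta_def)
  finally have "(\<lambda>n. \<Sum>i\<in>{n * 2..<n * 2 + 2}. ?f i) sums alt_zeta 1 (-1)"
    by (rule sums_group) simp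
  moreover have "(\<Sum>i\<in>{n * 2..<n * 2 + 2}. ?f i) = even_term 1 1 n - odd_term 1 1 n" for n
  proof -
    have "{n * 2..<n * 2 + 2} = {n * 2, Suc (n * 2)}" by auto
    then show ?thesis by (simp add: odd_term_def even_term_def algebra_simps)
  qed
  ultimately show ?thesis by simp
qed

lemma reducible_alt_zeta_1: "reducible (alt_zeta 1 (-1))"
  by (intro rational_polynomial_in_base) (force simp: alt_zeta_values_def)

lemma even_tail_tendsto:
  assumes "s \<in> {1, -1}" "r \<ge> 1"
  shows "(\<lambda>L. (\<Sum>j<L. even_term s r (j + k)) - divergent_part r s L) \<longlonglongrightarrow> even_tail s r k"
proof (cases "(r, s) = (1, 1)")
  case False
  then have "summable (\<lambda>j. even_term s r (j + k))"
    using even_term_tail(1)[OF assms] by (intro summable_ignore_initial_segment) auto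
  from summable_LIMSEQ[OF this] show ?thesis
    unfolding even_tail_def divergent_part_def if_not_P[OF False] by simp
next
  case True
  \<comment> \<open>The shift by k drops the first k even terms and adds k at the far end; the
    latter vanish as L grows.\<close>
  have eq: "(\<Sum>j<L. even_term 1 1 (j + k)) - (\<Sum>j<L. odd_term 1 1 j) =
      (\<Sum>j<L. even_term 1 1 j - odd_term 1 1 j) + (\<Sum>j<k. even_term 1 1 (L + j)) - (\<Sum>j<k. even_term 1 1 j)" for L
  proof -
    have "(\<Sum>j<k. even_term 1 1 j) + (\<Sum>j<L. even_term 1 1 (j + k)) = (\<Sum>j<k + L. even_term 1 1 j)"
      by (induction L) (auto simp: algebra_simps)
    also have "\<dots> = (\<Sum>j<L. even_term 1 1 j) + (\<Sum>j<k. even_term 1 1 (L + j))"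
      by (induction k) (auto simp: algebra_simps)
    finally show ?thesis by (simp add: sum_subtractf)
  qed
  have e0: "(\<lambda>L. even_term 1 1 (L + j)) \<longlonglongrightarrow> 0" for j
    unfolding even_term_def by simp real_asymp
  have "(\<lambda>L. (\<Sum>j<L. even_term 1 1 (j + k)) - (\<Sum>j<L. odd_term 1 1 j)) \<longlonglongrightarrow>
      alt_zeta 1 (-1) + (\<Sum>j<k. 0) - (\<Sum>j<k. even_term 1 1 j)"
    unfolding eq by (intro tendsto_intros e0 even_minus_odd_sums[unfolded sums_def])
  then show ?thesis using True by (simp add: even_tail_def divergent_part_def)
qed

text \<open>The bound -1/2 comes from the first term 1 - 1/2 of the positive series for ln 2, and is
  what the monotonicity argument in the next lemma uses. The second bound records logarithmic growth
  as a fourth root.\<close>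

lemma even_tail_1_1_bounds:
  shows "even_tail 1 1 k \<le> - 1 / 2"
    and "\<bar>even_tail 1 1 k\<bar> \<le> (\<bar>alt_zeta 1 (-1)\<bar> + 5) * (real k + 1) powr (1 / 4)"
proof -
  have E0: "(\<Sum>j<k. even_term 1 1 j) \<ge> 0" by (intro sum_nonneg) (simp add: even_term_def)
  have "(\<lambda>n. odd_term 1 1 n - even_term 1 1 n) sums (- alt_zeta 1 (-1))"
    using sums_minus[OF even_minus_odd_sums] by simp
  then have "(\<Sum>n<1. odd_term 1 1 n - even_term 1 1 n) \<le> - alt_zeta 1 (-1)"
    by (simp only: sums_iff, intro sum_le_suminf[THEN order_trans])
      (auto simp: odd_term_def even_term_def field_simps)
  then show "even_tail 1 1 k \<le> - 1 / 2"
    using E0 by (simp add: even_tail_def odd_term_def even_term_def)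
  have 1: "1 \<le> (real k + 1) powr (1 / 4)" by (intro ge_one_powr_ge_zero) auto
  have "\<bar>even_tail 1 1 k\<bar> \<le> \<bar>alt_zeta 1 (-1)\<bar> + \<bar>\<Sum>j<k. even_term 1 1 j\<bar>"
    by (simp add: even_tail_def)
  also have "\<dots> \<le> \<bar>alt_zeta 1 (-1)\<bar> * (real k + 1) powr (1 / 4) + 5 * (real k + 1) powr (1 / 4)"
    using 1 mult_left_mono[OF 1, of "\<bar>alt_zeta 1 (-1)\<bar>"]
    by (intro add_mono sum_abs_le_powr even_term_abs_le) auto
  finally show "\<bar>even_tail 1 1 k\<bar> \<le> (\<bar>alt_zeta 1 (-1)\<bar> + 5) * (real k + 1) powr (1 / 4)"
    by (simp add: algebra_simps)
qed

text \<open>The regularised tail grows like a logarithm. For u at least 2 the product is still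
  O(k^(-7/4)); for u = 1 the sign is -1 and Leibniz applies, giving tails of order n^(-3/4), again
  square-summable.\<close>

lemma odd_times_harmonic_tails:
  assumes s: "s \<in> {1, -1}" and u: "u \<ge> 1" "(u, s) \<noteq> (1, 1)"
  defines "G \<equiv> \<lambda>k. odd_term s u k * even_tail 1 1 k"
  shows "summable G" "summable (\<lambda>n. (\<Sum>i. G (i + n)) ^ 2)" "reducible (suminf G)"
proof -
  define C where "C = \<bar>alt_zeta 1 (-1)\<bar> + 5"
  have C: "C \<ge> 0" "\<And>k. \<bar>even_tail 1 1 k\<bar> \<le> C * (real k + 1) powr (1 / 4)"
    using even_tail_1_1_bounds(2) by (auto simp: C_def)
  have *: "summable G \<and> summable (\<lambda>n. (\<Sum>i. G (i + n)) ^ 2)"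
  proof (cases "u = 1")
    case False
    then have u2: "u \<ge> 2" using u by simp
    have "\<bar>G k\<bar> \<le> C * (real k + 1) powr (- 7 / 4)" for k
    proof -
      have "\<bar>s ^ k\<bar> = 1" using s by (auto simp: power_abs)
      then have "\<bar>odd_term s u k\<bar> = 1 / (2 * real k + 1) ^ u" by (simp add: odd_term_def abs_mult)
      also have "\<dots> \<le> 1 / (real k + 1) ^ u" using inverse_power_decreasing(2)[of 1] by simp
      also have "\<dots> \<le> 1 / (real k + 1) ^ 2"
        using u2 by (intro divide_left_mono power_increasing) auto
      finally have "\<bar>G k\<bar> \<le> 1 / (real k + 1) ^ 2 * (C * (real k + 1) powr (1 / 4))"
        unfolding G_def abs_mult using C by (intro mult_mono) auto
      also have "1 / (real k + 1) ^ 2 = (real k + 1) powr (- 2)"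
        by (simp add: powr_minus divide_inverse)
      also have "(real k + 1) powr (- 2) * (C * (real k + 1) powr (1 / 4)) =
          C * ((real k + 1) powr (- 2) * (real k + 1) powr (1 / 4))" by simp
      also have "\<dots> = C * (real k + 1) powr (- 7 / 4)" by (simp add: powr_add[symmetric])
      finally show ?thesis .
    qed
    from square_summable_tails[OF this] show ?thesis using summable_rabs_cancel by blast
  next
    case True
    then have s: "s = -1" using s u by auto
    define g where "g = (\<lambda>k. - even_tail 1 1 k / (2 * real k + 1))"
    have G: "G k = - ((-1) ^ k * g k)" for k
      by (simp add: G_def g_def odd_term_def s True)
    have g0: "0 \<le> g k" for k
      using even_tail_1_1_bounds(1)[of k] by (simp add: g_def divide_le_0_iff)
    have gdec: "g (Suc k) \<le> g k" for k
    proof -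
      define e where "e = - even_tail 1 1 k"
      have e: "e \<ge> 1 / 2" using even_tail_1_1_bounds(1)[of k] by (simp add: e_def)
      have suc: "- even_tail 1 1 (Suc k) = e + 1 / (2 * real k + 2)"
        by (simp add: e_def even_tail_def even_term_def)
      \<comment> \<open>Clearing denominators reduces this to (2k+1)/(2k+2) \<le> 2e, for which e at
        least 1/2 suffices.\<close>
      have main: "(e + 1 / (2 * real k + 2)) / (2 * real k + 3) \<le> e / (2 * real k + 1)"
      proof -
        have "(e + 1 / (2 * real k + 2)) * (2 * real k + 1) = e * (2 * real k + 1) + (2 * real k + 1) / (2 * real k + 2)"
          by (simp add: distrib_right)
        moreover have "(2 * real k + 1) / (2 * real k + 2) \<le> 1" by simp
        moreover have "e * (2 * real k + 1) + 2 * e = e * (2 * real k + 3)"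
          by (simp add: algebra_simps)
        ultimately have "(e + 1 / (2 * real k + 2)) * (2 * real k + 1) \<le> e * (2 * real k + 3)"
          using e by linarith
        then show ?thesis by (simp add: pos_divide_le_eq pos_le_divide_eq)
      qed
      have den: "2 * real (Suc k) + 1 = 2 * real k + 3" by simp
      show ?thesis using main unfolding g_def suc den e_def .
    qed
    have gle: "g k \<le> C * (real k + 1) powr (- 3 / 4)" for k
    proof -
      have "g k \<le> C * (real k + 1) powr (1 / 4) / (2 * real k + 1)"
        unfolding g_def using C(2)[of k] by (intro divide_right_mono) linarith+
      also have "\<dots> \<le> C * (real k + 1) powr (1 / 4) / (real k + 1)"
        using C(1) by (intro divide_left_mono) auto
      also have "\<dots> = C * (real k + 1) powr (- 3 / 4)"
        using powr_diff[of "real k + 1" "1 / 4" 1] by simp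
      finally show ?thesis .
    qed
    have "(\<lambda>k. C * (real k + 1) powr (- 3 / 4)) \<longlonglongrightarrow> 0" by real_asymp
    then have glim: "g \<longlonglongrightarrow> 0"
      by (rule Lim_null_comparison[rotated]) (use g0 gle in \<open>auto intro!: always_eventually\<close>)
    note alt = alternating_tail_le[of g, OF glim g0 gdec]
    have sG: "summable G" unfolding G[abs_def] using alt(1) by (rule summable_minus)
    have tails: "\<bar>\<Sum>i. G (i + n)\<bar> \<le> g n" for n
      unfolding G using alt(2)[of n] summable_ignore_initial_segment[OF alt(1), of n]
      by (subst suminf_minus) auto
    have "summable (\<lambda>n. C ^ 2 * (real n + 1) powr (- 3 / 2))"
    proof (rule summable_mult)
      show "summable (\<lambda>n. (real n + 1) powr (- 3 / 2))"
        using summable_ignore_initial_segment[of "\<lambda>i. real i powr (- 3 / 2)" 1]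
        by (simp add: summable_real_powr_iff add.commute)
    qed
    then have "summable (\<lambda>n. (\<Sum>i. G (i + n)) ^ 2)"
    proof (rule summable_comparison_test'[of _ 0])
      fix n
      have "\<bar>\<Sum>i. G (i + n)\<bar> \<le> C * (real n + 1) powr (- 3 / 4)" by (rule order_trans[OF tails gle])
      from power_mono[OF this, of 2]
      have "(\<Sum>i. G (i + n)) ^ 2 \<le> (C * (real n + 1) powr (- 3 / 4)) ^ 2" by simp
      also have "\<dots> = C ^ 2 * (real n + 1) powr (- 3 / 2)"
        by (simp add: power_mult_distrib power2_eq_square powr_add[symmetric])
      finally show "norm ((\<Sum>i. G (i + n)) ^ 2) \<le> C ^ 2 * (real n + 1) powr (- 3 / 2)" by simp
    qed
    with sG show ?thesis by simp
  qed
  then show "summable G" "summable (\<lambda>n. (\<Sum>i. G (i + n)) ^ 2)" by auto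
  \<comment> \<open>The regularised tail is a constant minus a partial sum of even reciprocals; the
    latter contributes an R-sum with inner exponent 1 and inner sign 1, which R-sums allow.\<close>
  have "(\<lambda>k. alt_zeta 1 (-1) * odd_term s u k - G k) sums
      (alt_zeta 1 (-1) * suminf (odd_term s u) - suminf G)"
    using * odd_term_tail(1)[OF s u] by (intro sums_diff sums_mult summable_sums) auto
  then have "(\<lambda>k. odd_term s u k * (\<Sum>j<k. even_term 1 1 j)) sums
      (alt_zeta 1 (-1) * suminf (odd_term s u) - suminf G)"
    by (simp add: G_def even_tail_def algebra_simps)
  then have "reducible (alt_zeta 1 (-1) * suminf (odd_term s u) - suminf G)"
    by (rule reducible_odd_even[rotated -1]) (use s u in auto)
  from rational_polynomial_in_diff[OF rational_polynomial_in_mult[OF reducible_alt_zeta_1 reducible_odd_sum[OF s u]] this]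
  show "reducible (suminf G)" by simp
qed

lemma odd_times_even_tail:
  assumes s: "s \<in> {1, -1}" "s' \<in> {1, -1}" and r: "r \<ge> 1" "u \<ge> 1" "(r, s) = (1, 1) \<Longrightarrow> (u, s') \<noteq> (1, 1)"
  defines "G \<equiv> \<lambda>k. odd_term s' u k * even_tail s r k"
  shows "summable G" "summable (\<lambda>n. (\<Sum>i. G (i + n)) ^ 2)" "reducible (suminf G)"
proof -
  have "summable G \<and> summable (\<lambda>n. (\<Sum>i. G (i + n)) ^ 2) \<and> reducible (suminf G)"
  proof (cases "(r, s) = (1, 1)")
    case True
    then have "G = (\<lambda>k. odd_term s' u k * even_tail 1 1 k)" by (simp add: G_def)
    then show ?thesis using odd_times_harmonic_tails[OF s(2) r(2) r(3)[OF True]] by simp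
  next
    case False
    have "even_tail s r = (\<lambda>k. \<Sum>n. even_term s r (n + k))"
      unfolding even_tail_def if_not_P[OF False] ..
    then show ?thesis using odd_times_even_tails[OF s r(1,2) False] by (simp add: G_def)
  qed
  then show "summable G" "summable (\<lambda>n. (\<Sum>i. G (i + n)) ^ 2)" "reducible (suminf G)" by auto
qed

section \<open>Summation of the partial fractions\<close>

text \<open>Summed over i < K, the terms telescope to tails of \<open>\<phi>\<close> at j and at j +
  K. The latter are O(1/K) uniformly in j, so absolute summability of \<open>P\<close> justifies the
  exchange although \<open>\<phi>\<close> may be only conditionally summable.\<close>

lemma sums_swap_tail:
  fixes P \<phi> :: "nat \<Rightarrow> real"
  assumes P: "summable (\<lambda>j. \<bar>P j\<bar>)" and \<phi>: "summable \<phi>" "\<And>N. \<bar>\<Sum>n. \<phi> (n + N)\<bar> \<le> 2 / (real N + 1)"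
    and \<phi>1: "\<And>n. \<bar>\<phi> n\<bar> \<le> 1"
  shows "summable (\<lambda>j. P j * \<phi> (i + j))"
    and "(\<lambda>i. \<Sum>j. P j * \<phi> (i + j)) sums (\<Sum>j. P j * (\<Sum>n. \<phi> (n + j)))"
proof -
  have bounded: "summable (\<lambda>j. \<bar>P j * x j\<bar>)" if "\<And>j. \<bar>x j\<bar> \<le> C" for x and C :: real
    by (rule summable_comparison_test'[OF summable_mult2[OF P, of C], of 0])
      (use that in \<open>auto simp: abs_mult intro!: mult_left_mono\<close>)
  show sm: "summable (\<lambda>j. P j * \<phi> (i + j))" for i
    by (rule summable_rabs_cancel[OF bounded[OF \<phi>1]])
  define \<Phi> where "\<Phi> = (\<lambda>N. \<Sum>n. \<phi> (n + N))"
  have \<Phi>: "\<bar>\<Phi> N\<bar> \<le> 2 / (real N + 1)" for N using \<phi>(2) by (simp add: \<Phi>_def)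
  have \<Phi>2: "\<bar>\<Phi> (j + K)\<bar> \<le> 2 / (real K + 1)" for j K
  proof -
    have "2 / (real (j + K) + 1) \<le> 2 / (real K + 1)" by (intro divide_left_mono) auto
    then show ?thesis using \<Phi>[of "j + K"] by linarith
  qed
  have sP: "summable (\<lambda>j. P j * \<Phi> (j + K))" for K
    by (rule summable_rabs_cancel[OF bounded[OF \<Phi>2]])
  have \<phi>_eq: "\<phi> n = \<Phi> n - \<Phi> (Suc n)" for n
    using suminf_split_head[OF summable_ignore_initial_segment[OF \<phi>(1), of n]]
    unfolding \<Phi>_def by simp
  have part: "(\<Sum>i<K. \<Sum>j. P j * \<phi> (i + j)) = (\<Sum>j. P j * \<Phi> j) - (\<Sum>j. P j * \<Phi> (j + K))" for K
  proof (induction K)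
    case (Suc K)
    have "(\<Sum>j. P j * \<phi> (K + j)) = (\<Sum>j. P j * \<Phi> (j + K) - P j * \<Phi> (j + Suc K))"
      by (simp add: \<phi>_eq algebra_simps)
    also have "\<dots> = (\<Sum>j. P j * \<Phi> (j + K)) - (\<Sum>j. P j * \<Phi> (j + Suc K))"
      by (rule suminf_diff[OF sP sP, symmetric])
    finally show ?case using Suc by simp
  qed simp
  have "(\<lambda>K. \<Sum>j. P j * \<Phi> (j + K)) \<longlonglongrightarrow> 0"
  proof (rule Lim_null_comparison)
    show "(\<lambda>K. 2 / (real K + 1) * (\<Sum>j. \<bar>P j\<bar>)) \<longlonglongrightarrow> 0"
      by (intro tendsto_mult_left_zero) real_asymp
    have "\<bar>\<Sum>j. P j * \<Phi> (j + K)\<bar> \<le> 2 / (real K + 1) * (\<Sum>j. \<bar>P j\<bar>)" for K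
    proof -
      have le: "\<bar>P j * \<Phi> (j + K)\<bar> \<le> 2 / (real K + 1) * \<bar>P j\<bar>" for j
      proof -
        have "\<bar>P j\<bar> * \<bar>\<Phi> (j + K)\<bar> \<le> \<bar>P j\<bar> * (2 / (real K + 1))"
          by (intro mult_left_mono \<Phi>2) simp
        then show ?thesis by (simp only: abs_mult mult.commute)
      qed
      have "\<bar>\<Sum>j. P j * \<Phi> (j + K)\<bar> \<le> (\<Sum>j. \<bar>P j * \<Phi> (j + K)\<bar>)"
        by (rule summable_rabs[OF bounded[OF \<Phi>2]])
      also have "\<dots> \<le> (\<Sum>j. 2 / (real K + 1) * \<bar>P j\<bar>)"
        by (intro suminf_le le bounded[OF \<Phi>2] summable_mult P)
      also have "\<dots> = 2 / (real K + 1) * (\<Sum>j. \<bar>P j\<bar>)" by (rule suminf_mult[OF P])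
      finally show ?thesis .
    qed
    then show "\<forall>\<^sub>F K in sequentially. norm (\<Sum>j. P j * \<Phi> (j + K)) \<le> 2 / (real K + 1) * (\<Sum>j. \<bar>P j\<bar>)"
      by simp
  qed
  from tendsto_diff[OF tendsto_const this, of "\<Sum>j. P j * \<Phi> j"]
  show "(\<lambda>i. \<Sum>j. P j * \<phi> (i + j)) sums (\<Sum>j. P j * (\<Sum>n. \<phi> (n + j)))"
    unfolding sums_def part by (simp add: \<Phi>_def)
qed

lemma odd_term_mult: "odd_term s r n * odd_term s' r' n = odd_term (s * s') (r + r') n"
  by (simp add: odd_term_def power_mult_distrib power_add)

text \<open>The limit is the total weight times the principal value of the odd series, minus the
  omitted term at y = 0, which \<open>G0\<close> controls.\<close>

lemma reducible_sym_sum_odd_int: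
  assumes s: "s \<in> {1, -1}" "r \<ge> 1"
    and G: "summable G" "summable (\<lambda>n. (\<Sum>i. G (i + n)) ^ 2)" "reducible (suminf G)"
    and G0: "reducible (\<Sum>i. G i * odd_term s r i)"
  obtains x where "reducible x" "sym_sum (\<lambda>y. \<Sum>i. G i * odd_int s r (y + int i)) \<longlonglongrightarrow> x"
    "\<And>y. summable (\<lambda>i. G i * odd_int s r (y + int i))"
proof -
  obtain w where w: "reducible w" "(\<lambda>N. odd_int s r 0 + sym_sum (odd_int s r) N) \<longlonglongrightarrow> w"
    using odd_int_window[OF s] by blast
  note c = sym_sum_correlation[of G "odd_int s r", OF G(1,2) odd_int_abs_le[OF s] w(2)]
  show ?thesis
    by (rule that[OF _ c(2) c(1)])
      (intro rational_polynomial_in_diff rational_polynomial_in_mult G w(1),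
        use G0 in \<open>simp add: odd_int_of_nat\<close>)
qed

section \<open>Sampling the partial fractions over the integers\<close>

locale triple_T =
  fixes m p q :: nat and s1 s2 s3 :: real
  assumes mpq: "m \<ge> 1" "p \<ge> 1" "q \<ge> 1"
    and signs: "s1 \<in> {1, -1}" "s2 \<in> {1, -1}" "s3 \<in> {1, -1}"
    and admissible: "(m, s1) \<noteq> (1, 1)" "(p, s2) \<noteq> (1, 1)"
begin

definition sign :: "int \<Rightarrow> nat \<Rightarrow> nat \<Rightarrow> real" where
  "sign y i j = s1 powi (y + int i) * s2 powi y * s3 powi (y - int j - 1)"

text \<open>The gaps are a - b = 2i+1, b - c = 2j+1 and a - c = 2(i+j)+2, so \<open>i\<close> and
  \<open>j\<close> enumerate all odd a above and all odd c below b = 2y.\<close>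

definition sample :: "(real \<Rightarrow> real \<Rightarrow> real \<Rightarrow> real) \<Rightarrow> int \<Rightarrow> nat \<Rightarrow> nat \<Rightarrow> real" where
  "sample F y i j = sign y i j *
     F (2 * of_int (y + int i) + 1) (2 * of_int y) (2 * of_int (y - int j - 1) + 1)"

text \<open>The coefficient \<open>W\<close> of the divergent part need not be known: as the divergent part tends to
  infinity, it is determined by the value of the left-hand side.\<close>

definition summable_to_reducible :: "(real \<Rightarrow> real \<Rightarrow> real \<Rightarrow> real) \<Rightarrow> bool" where
  "summable_to_reducible F \<longleftrightarrow> (\<exists>U W V r.
     (\<forall>y i. y \<noteq> 0 \<longrightarrow>
        (\<lambda>L. (\<Sum>j<L. sample F y i j) - divergent_part q s3 L * W y i) \<longlonglongrightarrow> U y i) \<and>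
     (\<forall>y. y \<noteq> 0 \<longrightarrow> U y sums V y) \<and> sym_sum V \<longlonglongrightarrow> r \<and> reducible r)"

text \<open>The sign that stays at the pole once the other two indices are measured from it.\<close>

abbreviation "\<tau> \<equiv> s1 * s2 * s3"

lemma \<tau>: "\<tau> \<in> {1, -1}"
  using signs by auto

lemma sign_rats: "s1 \<in> \<rat>" "s2 \<in> \<rat>" "s3 \<in> \<rat>"
  using signs by auto

text \<open>With x = y + i as the pole index, y = x - i and z = x - (j+i) - 1, so the gaps carry
  \<open>s2\<close> and \<open>s3\<close>. The next two lemmas take y and z as pole index.\<close>

lemma sign_eq_fst: "sign y i j = \<tau> powi (y + int i) * s2 ^ i * (s3 * s3 ^ (j + i))"
proof -
  have e: "y = (y + int i) - int i" "y - int j - 1 = (y + int i) - int (Suc (j + i))" by auto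
  have "s2 powi y = s2 powi (y + int i) * s2 ^ i"
    by (subst e(1)) (simp only: sign_powi(2)[OF signs(2)] power_int_of_nat)
  moreover have "s3 powi (y - int j - 1) = s3 powi (y + int i) * s3 ^ Suc (j + i)"
    by (subst e(2)) (simp only: sign_powi(2)[OF signs(3)] power_int_of_nat)
  ultimately show ?thesis
    by (simp add: sign_def power_int_mult_distrib mult_ac)
qed

lemma sign_eq_snd: "sign y i j = \<tau> powi y * s1 ^ i * (s3 * s3 ^ j)"
proof -
  have e: "y - int j - 1 = y - int (Suc j)" by auto
  have "s1 powi (y + int i) = s1 powi y * s1 ^ i"
    by (simp only: sign_powi(1)[OF signs(1)] power_int_of_nat)
  moreover have "s3 powi (y - int j - 1) = s3 powi y * s3 ^ Suc j"
    by (simp only: e sign_powi(2)[OF signs(3)] power_int_of_nat)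
  ultimately show ?thesis
    by (simp add: sign_def power_int_mult_distrib mult_ac)
qed

lemma sign_eq_trd: "sign y i j = \<tau> powi (y - int j - 1) * (s2 * s2 ^ j) * (s1 * s1 ^ (i + j))"
proof -
  have e: "y = (y - int j - 1) + int (Suc j)" "y + int i = (y - int j - 1) + int (Suc (i + j))" by auto
  have "s2 powi y = s2 powi (y - int j - 1) * s2 ^ Suc j"
    by (subst e(1)) (simp only: sign_powi(1)[OF signs(2)] power_int_of_nat)
  moreover have "s1 powi (y + int i) = s1 powi (y - int j - 1) * s1 ^ Suc (i + j)"
    by (subst e(2)) (simp only: sign_powi(1)[OF signs(1)] power_int_of_nat)
  ultimately show ?thesis
    by (simp add: sign_def power_int_mult_distrib mult_ac)
qed

lemma even_odd_admissible: "u \<ge> p \<Longrightarrow> (u, s2) \<noteq> (1, 1)" "v \<ge> m \<Longrightarrow> (v, s1) \<noteq> (1, 1)"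
  using admissible mpq by auto

text \<open>The sum over j is an even tail beyond i, the only place of the divergence; what remains
  over i and y is a correlation with the odd series at the pole a.\<close>

lemma summable_to_reducible_fst:
  assumes t: "t \<ge> 1" "u \<ge> p" "v \<ge> q"
  shows "summable_to_reducible (\<lambda>a b c. inverse a ^ t * inverse (a - b) ^ u * inverse (a - c) ^ v)"
proof -
  let ?F = "\<lambda>a b c. inverse a ^ t * inverse (a - b) ^ u * inverse (a - c) ^ v"
  have uv: "u \<ge> 1" "v \<ge> 1" using t mpq by auto
  define G where "G = (\<lambda>k. odd_term s2 u k * even_tail s3 v k)"
  have G: "summable G" "summable (\<lambda>n. (\<Sum>i. G (i + n)) ^ 2)" "reducible (suminf G)"
    unfolding G_def by (rule odd_times_even_tail[OF signs(3,2) uv(2,1) even_odd_admissible(1)[OF t(2)]])+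
  \<comment> \<open>The omitted value b = 0: there a - b equals the pole, so the two powers merge
    into one of exponent u + t.\<close>
  have "reducible (\<Sum>k. odd_term (s2 * \<tau>) (u + t) k * even_tail s3 v k)"
    by (rule odd_times_even_tail(3)) (use signs uv t in auto)
  moreover have "(\<Sum>k. odd_term (s2 * \<tau>) (u + t) k * even_tail s3 v k) = (\<Sum>i. G i * odd_term \<tau> t i)"
    by (simp only: G_def odd_term_mult[symmetric]) (simp only: mult_ac)
  ultimately have G0: "reducible (\<Sum>i. G i * odd_term \<tau> t i)" by simp
  obtain x where x: "reducible x" "sym_sum (\<lambda>y. \<Sum>i. G i * odd_int \<tau> t (y + int i)) \<longlonglongrightarrow> x"
    "\<And>y. summable (\<lambda>i. G i * odd_int \<tau> t (y + int i))"
    using reducible_sym_sum_odd_int[OF \<tau> t(1) G G0] by blast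
  have sample: "sample ?F y i j = s3 * (odd_int \<tau> t (y + int i) * odd_term s2 u i) * even_term s3 v (j + i)" for y i j
  proof -
    have e: "2 * of_int (y + int i) + 1 - 2 * of_int y = 2 * real i + 1"
      "2 * of_int (y + int i) + 1 - (2 * of_int (y - int j - 1) + 1) = 2 * real (j + i) + 2" by simp_all
    show ?thesis unfolding sample_def e sign_eq_fst
      by (simp add: odd_int_def odd_term_def even_term_def divide_inverse power_inverse)
  qed
  define c where "c = (if (v, s3) = (1, 1) then 1 else 0 :: real)"
  have div: "divergent_part v s3 L = divergent_part q s3 L * c" for L
    using t mpq by (auto simp: divergent_part_def c_def)
  show ?thesis
    unfolding summable_to_reducible_def
  proof (intro exI conjI allI impI)
    fix y i
    have "(\<lambda>L. s3 * (odd_int \<tau> t (y + int i) * odd_term s2 u i) *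
        ((\<Sum>j<L. even_term s3 v (j + i)) - divergent_part v s3 L)) \<longlonglongrightarrow>
        s3 * (odd_int \<tau> t (y + int i) * odd_term s2 u i) * even_tail s3 v i"
      by (intro tendsto_mult tendsto_const even_tail_tendsto[OF signs(3) uv(2)])
    then show "(\<lambda>L. (\<Sum>j<L. sample ?F y i j) - divergent_part q s3 L *
          (c * (s3 * (odd_int \<tau> t (y + int i) * odd_term s2 u i)))) \<longlonglongrightarrow>
        s3 * (G i * odd_int \<tau> t (y + int i))"
      unfolding sample div sum_distrib_left[symmetric] G_def by (simp add: algebra_simps)
  next
    fix y
    show "(\<lambda>i. s3 * (G i * odd_int \<tau> t (y + int i))) sums (s3 * (\<Sum>i. G i * odd_int \<tau> t (y + int i)))"
      by (intro sums_mult summable_sums x)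
  next
    show "sym_sum (\<lambda>y. s3 * (\<Sum>i. G i * odd_int \<tau> t (y + int i))) \<longlonglongrightarrow> s3 * x"
      unfolding sym_sum_scale[abs_def] by (intro tendsto_mult tendsto_const) (use x in simp)
    show "reducible (s3 * x)" by (intro rational_polynomial_in_scale sign_rats x)
  qed
qed

text \<open>The gaps from b to a and to c are independent, so the inner sums factor into
  one-variable odd sums and only the pole sum over b remains.\<close>

lemma summable_to_reducible_snd:
  assumes t: "t \<ge> 1" "u \<ge> m" "v \<ge> q"
  shows "summable_to_reducible (\<lambda>a b c. inverse b ^ t * inverse (a - b) ^ u * inverse (b - c) ^ v)"
proof -
  let ?F = "\<lambda>a b c. inverse b ^ t * inverse (a - b) ^ u * inverse (b - c) ^ v"
  have uv: "u \<ge> 1" "v \<ge> 1" "(u, s1) \<noteq> (1, 1)" using t mpq even_odd_admissible by auto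
  define g where "g = (\<lambda>y. \<tau> powi y * inverse (2 * of_int y) ^ t :: real)"
  have sample: "sample ?F y i j = s3 * (g y * odd_term s1 u i) * odd_term s3 v j" for y i j
  proof -
    have e: "2 * of_int (y + int i) + 1 - 2 * of_int y = 2 * real i + 1"
      "2 * of_int y - (2 * of_int (y - int j - 1) + 1) = 2 * real j + 1" by simp_all
    show ?thesis unfolding sample_def e sign_eq_snd
      by (simp only: g_def odd_term_def divide_inverse power_inverse mult_ac)
  qed
  obtain r where r: "reducible r" "sym_sum g \<longlonglongrightarrow> r"
  proof -
    have g: "g (int (Suc n)) + g (- int (Suc n)) = (1 + (-1) ^ t) * \<tau> * even_term \<tau> t n" for n
    proof -
      have e: "2 * real_of_int (int (Suc n)) = 2 * real n + 2"
        "2 * real_of_int (- int (Suc n)) = - (2 * real n + 2)" by simp_all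
      have "inverse (- (2 * real n + 2)) ^ t = (-1) ^ t * inverse (2 * real n + 2) ^ t"
        by (simp only: inverse_minus_eq power_minus[of "inverse _"])
      then show ?thesis unfolding g_def e sign_powi(3)[OF \<tau>]
        by (simp only: power_int_of_nat) (simp add: even_term_def divide_inverse power_inverse algebra_simps)
    qed
    have sym: "sym_sum g N = (1 + (-1) ^ t) * \<tau> * (\<Sum>n<N. even_term \<tau> t n)" for N
      by (simp only: sym_sum_def g sum_distrib_left)
    show ?thesis
    \<comment> \<open>For odd t the terms at b and -b cancel; an even t is at least 2, so the
      divergent series never has to be summed.\<close>
    proof (cases "even t")
      case True
      then have t2: "(t, \<tau>) \<noteq> (1, 1)" by auto
      have "sym_sum g \<longlonglongrightarrow> (1 + (-1) ^ t) * \<tau> * suminf (even_term \<tau> t)"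
        unfolding sym[abs_def]
        by (intro tendsto_intros summable_LIMSEQ even_term_tail(1)[OF \<tau> t(1) t2])
      moreover have "reducible ((1 + (-1) ^ t) * \<tau> * suminf (even_term \<tau> t))"
        using sign_rats by (intro rational_polynomial_in_scale reducible_even_sum[OF \<tau> t(1) t2]) auto
      ultimately show ?thesis using that by blast
    next
      case False
      then show ?thesis using rational_polynomial_in_Rats[of 0]
        by (intro that[of 0]) (simp_all add: sym[abs_def])
    qed
  qed
  define c where "c = (if (v, s3) = (1, 1) then 1 else 0 :: real)"
  have div: "divergent_part v s3 L = divergent_part q s3 L * c" for L
    using t mpq by (auto simp: divergent_part_def c_def)
  define K where "K = s3 * (suminf (odd_term s1 u) * odd_sum s3 v)"
  show ?thesis
    unfolding summable_to_reducible_def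
  proof (intro exI conjI allI impI)
    fix y i
    have "(\<lambda>L. s3 * (g y * odd_term s1 u i) *
        ((\<Sum>j<L. odd_term s3 v j) - divergent_part v s3 L)) \<longlonglongrightarrow>
        s3 * (g y * odd_term s1 u i) * odd_sum s3 v"
      by (intro tendsto_mult tendsto_const odd_sum_tendsto[OF signs(3) uv(2)])
    then show "(\<lambda>L. (\<Sum>j<L. sample ?F y i j) - divergent_part q s3 L *
          (c * (s3 * (g y * odd_term s1 u i)))) \<longlonglongrightarrow> (s3 * g y * odd_sum s3 v) * odd_term s1 u i"
      unfolding sample div sum_distrib_left[symmetric] by (simp add: algebra_simps)
  next
    fix y
    have "(\<lambda>i. (s3 * g y * odd_sum s3 v) * odd_term s1 u i) sums
        ((s3 * g y * odd_sum s3 v) * suminf (odd_term s1 u))"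
      by (intro sums_mult summable_sums odd_term_tail(1)[OF signs(1) uv(1,3)])
    then show "(\<lambda>i. (s3 * g y * odd_sum s3 v) * odd_term s1 u i) sums (K * g y)"
      by (simp add: K_def mult_ac)
  next
    show "sym_sum (\<lambda>y. K * g y) \<longlonglongrightarrow> K * r"
      unfolding sym_sum_scale[abs_def] by (intro tendsto_mult tendsto_const) (use r in simp)
    show "reducible (K * r)" unfolding K_def
      by (intro rational_polynomial_in_mult[OF rational_polynomial_in_scale] rational_polynomial_in_mult
          sign_rats r reducible_odd_sum[OF signs(1) uv(1,3)] reducible_odd_sum'[OF signs(3) uv(2)])
  qed
qed

text \<open>Here c runs first but is also the pole, so the sums over i and j must be exchanged. The
  pole factor makes the sum over j absolutely convergent, whence the coefficient 0 of the divergent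
  part. Reflecting c gives a correlation at -y, a change that symmetric windows do not see.\<close>

lemma summable_to_reducible_trd:
  assumes t: "t \<ge> 1" "u \<ge> p" "v \<ge> m"
  shows "summable_to_reducible (\<lambda>a b c. inverse c ^ t * inverse (b - c) ^ u * inverse (a - c) ^ v)"
proof -
  let ?F = "\<lambda>a b c. inverse c ^ t * inverse (b - c) ^ u * inverse (a - c) ^ v"
  have uv: "u \<ge> 1" "v \<ge> 1" "(v, s1) \<noteq> (1, 1)" using t mpq even_odd_admissible by auto
  define G where "G = (\<lambda>k. odd_term s2 u k * (\<Sum>n. even_term s1 v (n + k)))"
  have G: "summable G" "summable (\<lambda>n. (\<Sum>i. G (i + n)) ^ 2)" "reducible (suminf G)"
    unfolding G_def by (rule odd_times_even_tails[OF signs(1,2) uv(2,1,3)])+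
  have "reducible (\<Sum>k. odd_term (s2 * \<tau>) (u + t) k * (\<Sum>n. even_term s1 v (n + k)))"
    by (rule odd_times_even_tails(3)) (use signs uv in auto)
  moreover have "(\<Sum>k. odd_term (s2 * \<tau>) (u + t) k * (\<Sum>n. even_term s1 v (n + k))) = (\<Sum>i. G i * odd_term \<tau> t i)"
    by (simp only: G_def odd_term_mult[symmetric]) (simp only: mult_ac)
  ultimately have G0: "reducible (\<Sum>i. G i * odd_term \<tau> t i)" by simp
  obtain x where x: "reducible x" "sym_sum (\<lambda>y. \<Sum>i. G i * odd_int \<tau> t (y + int i)) \<longlonglongrightarrow> x"
    "\<And>y. summable (\<lambda>i. G i * odd_int \<tau> t (y + int i))"
    using reducible_sym_sum_odd_int[OF \<tau> t(1) G G0] by blast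
  define c where "c = s1 * s2 * (\<tau> * (-1) ^ t)"
  have c_rat: "c \<in> \<rat>" using sign_rats by (simp add: c_def)
  define P where "P = (\<lambda>y j. odd_term s2 u j * odd_int \<tau> t (y + int j))"
  have sample: "sample ?F y i j = c * (P (- y) j * even_term s1 v (i + j))" for y i j
  proof -
    have e: "2 * of_int y - (2 * of_int (y - int j - 1) + 1) = 2 * real j + 1"
      "2 * of_int (y + int i) + 1 - (2 * of_int (y - int j - 1) + 1) = 2 * real (i + j) + 2" by simp_all
    have "y - int j - 1 = - 1 - (- y + int j)" by simp
    then have "odd_int \<tau> t (y - int j - 1) = \<tau> * (-1) ^ t * odd_int \<tau> t (- y + int j)"
      by (simp only: odd_int_reflect[OF \<tau>])
    moreover have "sample ?F y i j =
        s1 * s2 * (odd_int \<tau> t (y - int j - 1) * (odd_term s2 u j * even_term s1 v (i + j)))"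
      unfolding sample_def e sign_eq_trd
      by (simp add: odd_int_def odd_term_def even_term_def divide_inverse power_inverse)
    ultimately show ?thesis by (simp add: c_def P_def mult_ac)
  qed
  have P: "summable (\<lambda>j. \<bar>P y j\<bar>)" for y
    unfolding P_def
  proof (rule square_summable_correlation(1)[OF _ odd_int_abs_le[OF \<tau> t(1)]])
    have "odd_term s2 u n ^ 2 \<le> 1 / (real n + 1) ^ 2" for n
      using power_mono[OF odd_term_abs_le[OF signs(2) uv(1), of n], of 2] by (simp add: power_divide)
    then show "summable (\<lambda>n. odd_term s2 u n ^ 2)"
      by (intro summable_comparison_test'[OF inverse_square_telescope(1)[of 0], of 0]) simp
  qed
  have le1: "\<bar>even_term s1 v n\<bar> \<le> 1" for n
  proof -
    have "1 / (real n + 1) \<le> 1" by simp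
    then show ?thesis using even_term_abs_le[OF signs(1) uv(2), of n] by linarith
  qed
  note swap = sums_swap_tail[OF P even_term_tail[OF signs(1) uv(2,3)] le1]
  have V: "(\<Sum>j. P y j * (\<Sum>n. even_term s1 v (n + j))) = (\<Sum>i. G i * odd_int \<tau> t (y + int i))" for y
    by (simp only: P_def G_def mult_ac)
  show ?thesis
    unfolding summable_to_reducible_def
  proof (intro exI conjI allI impI)
    fix y i
    show "(\<lambda>L. (\<Sum>j<L. sample ?F y i j) - divergent_part q s3 L * 0) \<longlonglongrightarrow>
        c * (\<Sum>j. P (- y) j * even_term s1 v (i + j))"
      unfolding sample sum_distrib_left[symmetric] mult_zero_right diff_zero
      by (intro tendsto_mult tendsto_const summable_LIMSEQ swap(1))
  next
    fix y
    show "(\<lambda>i. c * (\<Sum>j. P (- y) j * even_term s1 v (i + j))) sums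
        (c * (\<Sum>i. G i * odd_int \<tau> t (- y + int i)))"
      using sums_mult[OF swap(2)[of "- y"], of c] by (simp only: V)
  next
    have "sym_sum (\<lambda>y. \<Sum>i. G i * odd_int \<tau> t (- y + int i)) =
        sym_sum (\<lambda>y. \<Sum>i. G i * odd_int \<tau> t (y + int i))"
      unfolding sym_sum_def minus_minus by (intro ext sum.cong refl add.commute)
    then show "sym_sum (\<lambda>y. c * (\<Sum>i. G i * odd_int \<tau> t (- y + int i))) \<longlonglongrightarrow> c * x"
      unfolding sym_sum_scale[abs_def] using x(2) by (intro tendsto_mult tendsto_const) simp
    show "reducible (c * x)" by (intro rational_polynomial_in_scale c_rat x)
  qed
qed

lemma summable_to_reducibleE:
  assumes "summable_to_reducible F"
  obtains U W V r where "\<And>y i. y \<noteq> 0 \<Longrightarrow>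
        (\<lambda>L. (\<Sum>j<L. sample F y i j) - divergent_part q s3 L * W y i) \<longlonglongrightarrow> U y i"
     "\<And>y. y \<noteq> 0 \<Longrightarrow> U y sums V y" "sym_sum V \<longlonglongrightarrow> r" "reducible r"
  using assms unfolding summable_to_reducible_def by (elim exE conjE, intro that) auto

lemma parfrac_span_summable_to_reducible:
  "parfrac_span m p q F \<Longrightarrow> summable_to_reducible F"
proof (induction rule: parfrac_span.induct)
  case (add F G)
  obtain U W V r where F: "\<And>y i. y \<noteq> 0 \<Longrightarrow>
        (\<lambda>L. (\<Sum>j<L. sample F y i j) - divergent_part q s3 L * W y i) \<longlonglongrightarrow> U y i"
     "\<And>y. y \<noteq> 0 \<Longrightarrow> U y sums V y" "sym_sum V \<longlonglongrightarrow> r" "reducible r"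
    by (rule summable_to_reducibleE[OF add.IH(1)]) (rule that)
  obtain U' W' V' r' where G: "\<And>y i. y \<noteq> 0 \<Longrightarrow>
        (\<lambda>L. (\<Sum>j<L. sample G y i j) - divergent_part q s3 L * W' y i) \<longlonglongrightarrow> U' y i"
     "\<And>y. y \<noteq> 0 \<Longrightarrow> U' y sums V' y" "sym_sum V' \<longlonglongrightarrow> r'" "reducible r'"
    by (rule summable_to_reducibleE[OF add.IH(2)]) (rule that)
  have s: "sample (\<lambda>a b c. F a b c + G a b c) y i j = sample F y i j + sample G y i j" for y i j
    by (simp add: sample_def algebra_simps)
  show ?case unfolding summable_to_reducible_def
  proof (intro exI conjI allI impI)
    fix y :: int and i
    assume "y \<noteq> 0"
    from tendsto_add[OF F(1)[OF this] G(1)[OF this], of i i]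
    show "(\<lambda>L. (\<Sum>j<L. sample (\<lambda>a b c. F a b c + G a b c) y i j) - divergent_part q s3 L * (W y i + W' y i))
        \<longlonglongrightarrow> U y i + U' y i"
      by (simp add: s sum.distrib algebra_simps)
  next
    fix y :: int
    assume "y \<noteq> 0"
    then show "(\<lambda>i. U y i + U' y i) sums (V y + V' y)" by (intro sums_add F G)
  next
    show "sym_sum (\<lambda>y. V y + V' y) \<longlonglongrightarrow> r + r'"
      unfolding sym_sum_add[abs_def] using F(3) G(3) by (intro tendsto_add)
    show "reducible (r + r')" by (intro rational_polynomial_in_add F G)
  qed
next
  case (scale F c)
  obtain U W V r where F: "\<And>y i. y \<noteq> 0 \<Longrightarrow>
        (\<lambda>L. (\<Sum>j<L. sample F y i j) - divergent_part q s3 L * W y i) \<longlonglongrightarrow> U y i"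
     "\<And>y. y \<noteq> 0 \<Longrightarrow> U y sums V y" "sym_sum V \<longlonglongrightarrow> r" "reducible r"
    by (rule summable_to_reducibleE[OF scale.IH]) (rule that)
  have s: "sample (\<lambda>a b d. of_rat c * F a b d) y i j = of_rat c * sample F y i j" for y i j
    by (simp add: sample_def)
  show ?case unfolding summable_to_reducible_def
  proof (intro exI conjI allI impI)
    fix y :: int and i
    assume "y \<noteq> 0"
    from tendsto_mult[OF tendsto_const F(1)[OF this], of "of_rat c" i]
    show "(\<lambda>L. (\<Sum>j<L. sample (\<lambda>a b d. of_rat c * F a b d) y i j) - divergent_part q s3 L * (of_rat c * W y i))
        \<longlonglongrightarrow> of_rat c * U y i"
      by (simp add: s sum_distrib_left[symmetric] algebra_simps)
  next
    fix y :: int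
    assume "y \<noteq> 0"
    then show "(\<lambda>i. of_rat c * U y i) sums (of_rat c * V y)" by (intro sums_mult F)
  next
    show "sym_sum (\<lambda>y. of_rat c * V y) \<longlonglongrightarrow> of_rat c * r"
      unfolding sym_sum_scale[abs_def] using F(3) by (intro tendsto_mult tendsto_const)
    show "reducible (of_rat c * r)" by (intro rational_polynomial_in_scale F) auto
  qed
qed (intro summable_to_reducible_fst summable_to_reducible_snd summable_to_reducible_trd; assumption)+

end

section \<open>Reflection\<close>

text \<open>The divergent part is either identically 0 or tends to infinity; in the latter case a
  convergent multiple of it is the zero multiple.\<close>

lemma divergent_part_limit_0:
  assumes "(\<lambda>L. divergent_part q s L * c) \<longlonglongrightarrow> d"
  shows "d = 0"
proof (cases "(q, s) = (1, 1)")
  case True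
  have inv: "(\<lambda>L. inverse (divergent_part 1 1 L)) \<longlonglongrightarrow> 0"
    using divergent_part_at_top by (rule tendsto_inverse_0_at_top)
  have "(\<lambda>L. divergent_part 1 1 L * c * inverse (divergent_part 1 1 L)) \<longlonglongrightarrow> d * 0"
    using assms True by (intro tendsto_mult inv) auto
  moreover have "\<forall>\<^sub>F L in sequentially. divergent_part 1 1 L * c * inverse (divergent_part 1 1 L) = c"
    using divergent_part_at_top[unfolded filterlim_at_top_dense, rule_format, of 0]
    by eventually_elim simp
  ultimately have "(\<lambda>L. c) \<longlonglongrightarrow> d * 0" by (rule Lim_transform_eventually)
  then have "c = 0" by (simp add: LIMSEQ_const_iff)
  then show ?thesis using assms by (simp add: LIMSEQ_const_iff)
next
  case False
  then have "divergent_part q s = (\<lambda>L. 0)" by (auto simp: divergent_part_def)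
  then show ?thesis using assms by (simp add: LIMSEQ_const_iff)
qed

section \<open>Inner and outer sums as functions of the middle index\<close>

context triple_T
begin

definition even_int :: "int \<Rightarrow> real" where
  "even_int y = s2 powi y * inverse (2 * of_int y) ^ p"

lemma sample_eq:
  assumes F: "\<And>a b c. generic_triple a b c \<Longrightarrow> F a b c = inverse a ^ m * inverse b ^ p * inverse c ^ q"
    and y: "y \<noteq> 0"
  shows "sample F y i j = odd_int s1 m (y + int i) * even_int y * odd_int s3 q (y - int j - 1)"
proof -
  \<comment> \<open>Parity keeps a and c away from 0 and from b, so only b = 0 has to be
    excluded.\<close>
  have g: "generic_triple (of_int a) (of_int b) (of_int c)"
    if "odd a" "odd c" "even b" "b \<noteq> 0" "a \<noteq> c" for a b c :: int
    using that by (auto simp: generic_triple_def)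
  have "generic_triple (of_int (2 * (y + int i) + 1)) (of_int (2 * y)) (of_int (2 * (y - int j - 1) + 1))"
    using y by (intro g) auto
  then have generic: "generic_triple (2 * of_int (y + int i) + 1) (2 * of_int y) (2 * of_int (y - int j - 1) + 1)"
    by simp
  show ?thesis
    unfolding sample_def F[OF generic]
    by (simp only: sign_def odd_int_def even_int_def divide_inverse power_inverse mult_ac)
qed

text \<open>Product form and partial fractions have the same partial sums over j, so their
  regularised limits differ by the limit of a multiple of the divergent part, hence not at all. In
  \<open>C\<close> that part is added because c runs through negative numbers.\<close>

lemma reducible_sym_sum_product:
  assumes A: "\<And>y. y \<noteq> 0 \<Longrightarrow> (\<lambda>i. odd_int s1 m (y + int i)) sums A y"
    and C: "\<And>y. y \<noteq> 0 \<Longrightarrow>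
      (\<lambda>L. (\<Sum>j<L. odd_int s3 q (y - int j - 1)) + divergent_part q s3 L) \<longlonglongrightarrow> C y"
  obtains r where "reducible r" "sym_sum (\<lambda>y. even_int y * A y * C y) \<longlonglongrightarrow> r"
proof -
  obtain F where F: "parfrac_span m p q F"
    "\<And>a b c. generic_triple a b c \<Longrightarrow> F a b c = inverse a ^ m * inverse b ^ p * inverse c ^ q"
    using parfrac_exists[OF mpq] by blast
  obtain U W V r where UV: "\<And>y i. y \<noteq> 0 \<Longrightarrow>
        (\<lambda>L. (\<Sum>j<L. sample F y i j) - divergent_part q s3 L * W y i) \<longlonglongrightarrow> U y i"
     "\<And>y. y \<noteq> 0 \<Longrightarrow> U y sums V y" "sym_sum V \<longlonglongrightarrow> r" "reducible r"
    by (rule summable_to_reducibleE[OF parfrac_span_summable_to_reducible[OF F(1)]]) (rule that)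
  have U: "U y i = even_int y * C y * odd_int s1 m (y + int i)" if y: "y \<noteq> 0" for y i
  proof -
    define f where "f = odd_int s1 m (y + int i) * even_int y"
    have "(\<lambda>L. f * ((\<Sum>j<L. odd_int s3 q (y - int j - 1)) + divergent_part q s3 L)
        - ((\<Sum>j<L. sample F y i j) - divergent_part q s3 L * W y i)) \<longlonglongrightarrow> f * C y - U y i"
      by (intro tendsto_diff tendsto_mult tendsto_const C UV y)
    then have "(\<lambda>L. divergent_part q s3 L * (f + W y i)) \<longlonglongrightarrow> f * C y - U y i"
      by (simp add: sample_eq[OF F(2) y] f_def sum_distrib_left algebra_simps)
    from divergent_part_limit_0[OF this] show ?thesis by (simp add: f_def mult_ac)
  qed
  have V: "V y = even_int y * A y * C y" if y: "y \<noteq> 0" for y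
  proof (rule sums_unique2[OF UV(2)[OF y]])
    have "U y = (\<lambda>i. even_int y * C y * odd_int s1 m (y + int i))" by (rule ext) (rule U[OF y])
    then show "U y sums (even_int y * A y * C y)"
      using sums_mult[OF A[OF y], of "even_int y * C y"] by (simp add: mult_ac)
  qed
  have "sym_sum V = sym_sum (\<lambda>y. even_int y * A y * C y)"
    by (rule ext) (simp add: sym_sum_def V)
  then show ?thesis using that UV(3,4) by simp
qed

definition outer_sum :: real where "outer_sum = suminf (odd_term s1 m)"

definition outer_tail :: "nat \<Rightarrow> real" where "outer_tail n = (\<Sum>k. odd_term s1 m (k + n))"

definition inner_sum :: "nat \<Rightarrow> real" where "inner_sum n = (\<Sum>z<n. odd_term s3 q z)"

text \<open>The regularised sum over all c < 0, folded onto the positive odd numbers.\<close>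

definition inner_const :: real where "inner_const = s3 * (-1) ^ q * odd_sum s3 q"

lemma outer_pos: "(\<lambda>i. odd_int s1 m (int n + int i)) sums outer_tail n"
proof -
  have "odd_int s1 m (int n + int i) = odd_term s1 m (i + n)" for i
    using odd_int_of_nat[of s1 m "i + n"] by (simp add: add.commute)
  then show ?thesis
    unfolding outer_tail_def
    using summable_ignore_initial_segment[OF odd_term_tail(1)[OF signs(1) mpq(1) admissible(1)], of n]
    by (simp add: summable_sums)
qed

lemma outer_tail_eq: "(\<Sum>x<n. odd_term s1 m x) = outer_sum - outer_tail n"
  using suminf_split_initial_segment[OF odd_term_tail(1)[OF signs(1) mpq(1) admissible(1)], of n]
  by (simp add: outer_sum_def outer_tail_def)

text \<open>The odd numbers above -2n are all positive ones and the negatives of the first n;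
  passing to n + 1 adds the single index -1 - n.\<close>

lemma outer_neg:
  "(\<lambda>i. odd_int s1 m (- int n + int i)) sums (outer_sum + s1 * (-1) ^ m * (outer_sum - outer_tail n))"
  unfolding outer_tail_eq[symmetric]
proof (induction n)
  case 0
  then show ?case using outer_pos[of 0] by (simp add: outer_tail_def outer_sum_def)
next
  case (Suc n)
  have e: "- int (Suc n) + int (Suc i) = - int n + int i" "- int (Suc n) + int 0 = - 1 - int n" for i
    by simp_all
  have "(\<lambda>i. odd_int s1 m (- int (Suc n) + int (Suc i))) sums (outer_sum + s1 * (-1) ^ m * (\<Sum>x<n. odd_term s1 m x))"
    using Suc by (simp only: e)
  then have "(\<lambda>i. odd_int s1 m (- int (Suc n) + int i)) sums
      (outer_sum + s1 * (-1) ^ m * (\<Sum>x<n. odd_term s1 m x) + odd_int s1 m (- int (Suc n) + int 0))"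
    by (rule sums_Suc_iff[of "\<lambda>i. odd_int s1 m (- int (Suc n) + int i)", THEN iffD1])
  then show ?case
    unfolding e(2) odd_int_reflect[OF signs(1)] odd_int_of_nat by (simp add: algebra_simps)
qed

abbreviation "inner_limit y c \<equiv>
  (\<lambda>L. (\<Sum>j<L. odd_int s3 q (y - int j - 1)) + divergent_part q s3 L) \<longlonglongrightarrow> c"

lemma inner_0: "inner_limit 0 inner_const"
proof -
  have "odd_int s3 q (0 - int j - 1) = s3 * (-1) ^ q * odd_term s3 q j" for j
  proof -
    have "0 - int j - 1 = - 1 - int j" by simp
    then show ?thesis by (simp only: odd_int_reflect[OF signs(3)] odd_int_of_nat)
  qed
  then have "(\<Sum>j<L. odd_int s3 q (0 - int j - 1)) + divergent_part q s3 L =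
      s3 * (-1) ^ q * ((\<Sum>j<L. odd_term s3 q j) - divergent_part q s3 L)" for L
    by (cases "(q, s3) = (1, 1)")
      (auto simp: sum_distrib_left[symmetric] sum_negf divergent_part_def right_diff_distrib)
  then show ?thesis
    unfolding inner_const_def using odd_sum_tendsto[OF signs(3) mpq(3)]
    by (simp only:) (intro tendsto_mult tendsto_const)
qed

text \<open>Moving y up by one admits the index y and loses the index y - L, whose term vanishes.
  The divergent parts cancel in the difference.\<close>

lemma inner_shift:
  "(\<lambda>L. ((\<Sum>j<L. odd_int s3 q (y + 1 - int j - 1)) + divergent_part q s3 L)
     - ((\<Sum>j<L. odd_int s3 q (y - int j - 1)) + divergent_part q s3 L)) \<longlonglongrightarrow> odd_int s3 q y"
proof -
  have "(\<Sum>j<L. odd_int s3 q (y + 1 - int j - 1)) =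
      (\<Sum>j<L. odd_int s3 q (y - int j - 1)) + odd_int s3 q y - odd_int s3 q (y - int L)" for L
    by (induction L) (auto simp: algebra_simps)
  then have "(\<lambda>L. ((\<Sum>j<L. odd_int s3 q (y + 1 - int j - 1)) + divergent_part q s3 L)
     - ((\<Sum>j<L. odd_int s3 q (y - int j - 1)) + divergent_part q s3 L)) =
     (\<lambda>L. odd_int s3 q y - odd_int s3 q (y - int L))" by (simp add: fun_eq_iff)
  then show ?thesis
    using tendsto_diff[OF tendsto_const
      tendsto_odd_reciprocal_shift(2)[of "odd_int s3 q", OF odd_int_abs_le[OF signs(3) mpq(3)]]] by simp
qed

lemma inner_pos: "inner_limit (int n) (inner_const + inner_sum n)"
proof (induction n)
  case 0
  then show ?case using inner_0 by (simp add: inner_sum_def)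
next
  case (Suc n)
  have e: "int n + 1 = int (Suc n)" by simp
  from tendsto_add[OF Suc inner_shift[of "int n"]] show ?case
    unfolding e odd_int_of_nat by (simp add: inner_sum_def add_ac)
qed

lemma inner_neg: "inner_limit (- int n) (inner_const - s3 * (-1) ^ q * inner_sum n)"
proof (induction n)
  case 0
  then show ?case using inner_0 by (simp add: inner_sum_def)
next
  case (Suc n)
  have e: "- 1 - int n + 1 = - int n" "- int (Suc n) = - 1 - int n" by simp_all
  from tendsto_diff[OF Suc inner_shift[of "- 1 - int n", unfolded e(1)]] show ?case
    unfolding e(2) odd_int_reflect[OF signs(3)] odd_int_of_nat
    by (simp add: inner_sum_def algebra_simps)
qed

lemma even_int_pos: "even_int (int (Suc n)) = s2 * even_term s2 p n"
  and even_int_neg: "even_int (- int (Suc n)) = (-1) ^ p * (s2 * even_term s2 p n)"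
proof -
  have e: "2 * real_of_int (int (Suc n)) = 2 * real n + 2"
    "2 * real_of_int (- int (Suc n)) = - (2 * real n + 2)" by simp_all
  have "inverse (- (2 * real n + 2)) ^ p = (-1) ^ p * inverse (2 * real n + 2) ^ p"
    by (simp only: inverse_minus_eq power_minus[of "inverse _"])
  then show "even_int (int (Suc n)) = s2 * even_term s2 p n"
    "even_int (- int (Suc n)) = (-1) ^ p * (s2 * even_term s2 p n)"
    unfolding even_int_def e sign_powi(3)[OF signs(2)]
    by (simp_all only: power_int_of_nat)
      (simp_all add: even_term_def divide_inverse power_inverse)
qed

lemma reducible_outer_sum: "reducible outer_sum"
  unfolding outer_sum_def by (rule reducible_odd_sum[OF signs(1) mpq(1) admissible(1)])

lemma reducible_inner_const: "reducible inner_const"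
  unfolding inner_const_def using sign_rats
  by (intro rational_polynomial_in_scale reducible_odd_sum'[OF signs(3) mpq(3)]) auto

lemma even_sums:
  obtains x where "(\<lambda>n. s2 * even_term s2 p n) sums x" "reducible x"
  by (rule that[OF sums_mult[OF summable_sums[OF even_term_tail(1)[OF signs(2) mpq(2) admissible(2)]]]])
    (intro rational_polynomial_in_scale sign_rats reducible_even_sum[OF signs(2) mpq(2) admissible(2)])

lemma even_times_outer_sums:
  obtains x where "(\<lambda>n. s2 * even_term s2 p n * outer_tail (Suc n)) sums x" "reducible x"
proof -
  note e = even_times_odd_tails[OF signs(1,2) mpq(1,2) admissible(1)]
  have "(\<lambda>n. s2 * (even_term s2 p n * outer_tail (Suc n))) sums
      (s2 * (\<Sum>n. even_term s2 p n * outer_tail (Suc n)))"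
    unfolding outer_tail_def by (intro sums_mult summable_sums e(1))
  then show ?thesis
    by (intro that) (simp_all only: mult.assoc,
      unfold outer_tail_def, intro rational_polynomial_in_scale sign_rats e(2))
qed

lemma even_times_inner_sums:
  obtains x where "(\<lambda>n. s2 * even_term s2 p n * inner_sum (Suc n)) sums x" "reducible x"
proof -
  note o = odd_times_even_tails[OF signs(2,3) mpq(2,3) admissible(2)]
  from sums_mult[OF o(4), of s2] show ?thesis
    by (intro that) (simp_all only: inner_sum_def lessThan_Suc_atMost mult.assoc,
      intro rational_polynomial_in_scale sign_rats o(3))
qed

text \<open>With sign product -1 the triple product would cancel between 2y and -2y; with product 1
  it survives with coefficient 2 and is isolated as \<open>X\<close>.\<close>

lemma reducible_nested_sum:
  assumes parity: "s1 * (-1) ^ m * (-1) ^ p * (s3 * (-1) ^ q) = 1"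
  obtains x where "reducible x"
    "(\<lambda>n. odd_term s1 m (Suc n) * (\<Sum>k\<le>n. even_term s2 p k * inner_sum (Suc k))) sums x"
proof -
  define \<epsilon>1 \<epsilon>2 \<epsilon>3 where \<epsilon>: "\<epsilon>1 = s1 * (-1) ^ m" "\<epsilon>2 = (-1 :: real) ^ p" "\<epsilon>3 = s3 * (-1) ^ q"
  have \<epsilon>_rat: "\<epsilon>1 \<in> \<rat>" "\<epsilon>2 \<in> \<rat>" "\<epsilon>3 \<in> \<rat>" using sign_rats by (auto simp: \<epsilon>)
  define A where "A = (\<lambda>y. if y \<ge> 0 then outer_tail (nat y)
    else outer_sum + \<epsilon>1 * (outer_sum - outer_tail (nat (- y))))"
  define C where "C = (\<lambda>y. if y \<ge> 0 then inner_const + inner_sum (nat y)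
    else inner_const - \<epsilon>3 * inner_sum (nat (- y)))"
  have A: "(\<lambda>i. odd_int s1 m (y + int i)) sums A y" for y
    using outer_pos[of "nat y"] outer_neg[of "nat (- y)"] by (cases "y \<ge> 0") (simp_all add: A_def \<epsilon>)
  have C: "inner_limit y (C y)" for y
    using inner_pos[of "nat y"] inner_neg[of "nat (- y)"] by (cases "y \<ge> 0") (simp_all add: C_def \<epsilon>)
  obtain r where r: "reducible r" "sym_sum (\<lambda>y. even_int y * A y * C y) \<longlonglongrightarrow> r"
    by (rule reducible_sym_sum_product[of A C, OF A C]) (rule that)
  define e where "e = (\<lambda>n. s2 * even_term s2 p n)"
  define t where "t = (\<lambda>n. outer_tail (Suc n))"
  define c where "c = (\<lambda>n. inner_sum (Suc n))"
  have pair: "even_int (int (Suc n)) * A (int (Suc n)) * C (int (Suc n)) +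
      even_int (- int (Suc n)) * A (- int (Suc n)) * C (- int (Suc n)) =
      2 * (e n * t n * c n) + (inner_const * (1 - \<epsilon>1 * \<epsilon>2)) * (e n * t n)
      - (\<epsilon>2 * \<epsilon>3 * (1 + \<epsilon>1) * outer_sum) * (e n * c n)
      + (\<epsilon>2 * (1 + \<epsilon>1) * outer_sum * inner_const) * e n" for n
  proof -
    have AC: "A (int (Suc n)) = t n" "A (- int (Suc n)) = outer_sum + \<epsilon>1 * (outer_sum - t n)"
      "C (int (Suc n)) = inner_const + c n" "C (- int (Suc n)) = inner_const - \<epsilon>3 * c n"
      by (simp_all add: A_def C_def t_def c_def nat_add_distrib)
    have ee: "even_int (int (Suc n)) = e n" "even_int (- int (Suc n)) = \<epsilon>2 * e n"
      by (simp_all only: even_int_pos even_int_neg e_def \<epsilon>)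
    have "even_int (int (Suc n)) * A (int (Suc n)) * C (int (Suc n)) +
      even_int (- int (Suc n)) * A (- int (Suc n)) * C (- int (Suc n)) =
      (1 + \<epsilon>1 * \<epsilon>2 * \<epsilon>3) * (e n * t n * c n) + (inner_const * (1 - \<epsilon>1 * \<epsilon>2)) * (e n * t n)
      - (\<epsilon>2 * \<epsilon>3 * (1 + \<epsilon>1) * outer_sum) * (e n * c n)
      + (\<epsilon>2 * (1 + \<epsilon>1) * outer_sum * inner_const) * e n"
      unfolding AC ee by (simp add: algebra_simps)
    also have "1 + \<epsilon>1 * \<epsilon>2 * \<epsilon>3 = 2" using parity by (simp add: \<epsilon>)
    finally show ?thesis .
  qed
  \<comment> \<open>The companions of the triple product, up to rational factors: with the outer
    tail an R-sum, with the inner partial sum a double T-value, alone a zeta value.\<close>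
  obtain x1 where x1: "(\<lambda>n. e n * t n) sums x1" "reducible x1"
    by (rule even_times_outer_sums) (rule that, unfold e_def t_def, assumption+)
  obtain x2 where x2: "(\<lambda>n. e n * c n) sums x2" "reducible x2"
    by (rule even_times_inner_sums) (rule that, unfold e_def c_def, assumption+)
  obtain x3 where x3: "e sums x3" "reducible x3"
    by (rule even_sums) (rule that, unfold e_def, assumption+)
  define X where "X = 1 / 2 * (r - (inner_const * (1 - \<epsilon>1 * \<epsilon>2)) * x1
      + (\<epsilon>2 * \<epsilon>3 * (1 + \<epsilon>1) * outer_sum) * x2 - (\<epsilon>2 * (1 + \<epsilon>1) * outer_sum * inner_const) * x3)"
  have "reducible X"
    unfolding X_def
    by (intro rational_polynomial_in_diff rational_polynomial_in_add rational_polynomial_in_mult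
        reducible_inner_const reducible_outer_sum r x1 x2 x3 \<epsilon>_rat[THEN rational_polynomial_in_Rats]
        rational_polynomial_in_Rats[of 1] rational_polynomial_in_Rats[of "1 / 2"]) simp_all
  have r': "(\<lambda>n. 2 * (e n * t n * c n) + (inner_const * (1 - \<epsilon>1 * \<epsilon>2)) * (e n * t n)
      - (\<epsilon>2 * \<epsilon>3 * (1 + \<epsilon>1) * outer_sum) * (e n * c n)
      + (\<epsilon>2 * (1 + \<epsilon>1) * outer_sum * inner_const) * e n) sums r"
    using r(2) by (simp only: sums_def sym_sum_def[abs_def] pair)
  have X: "(\<lambda>n. e n * t n * c n) sums X"
    using sums_mult[OF sums_diff[OF sums_add[OF sums_diff[OF r'
      sums_mult[OF x1(1), of "inner_const * (1 - \<epsilon>1 * \<epsilon>2)"]]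
      sums_mult[OF x2(1), of "\<epsilon>2 * \<epsilon>3 * (1 + \<epsilon>1) * outer_sum"]]
      sums_mult[OF x3(1), of "\<epsilon>2 * (1 + \<epsilon>1) * outer_sum * inner_const"]], of "1 / 2"]
    by (simp add: X_def)
  \<comment> \<open>Back from tails to the nested order: the boundary term is \<open>t\<close>,
    tending to 0, times partial sums converging to \<open>x2\<close>.\<close>
  have "(\<lambda>n. odd_term s1 m (Suc n) * (\<Sum>k\<le>n. e k * c k)) sums X"
  proof (rule tail_swap)
    note tail = odd_term_tail[OF signs(1) mpq(1) admissible(1)]
    show "summable (\<lambda>n. odd_term s1 m (Suc n))" using tail(1) by (simp add: summable_Suc_iff)
    have t: "(\<Sum>n. odd_term s1 m (Suc (n + N))) = t N" for N by (simp add: t_def outer_tail_def)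
    have "t \<longlonglongrightarrow> 0"
    proof (rule Lim_null_comparison)
      show "(\<lambda>N. 2 / (real (Suc N) + 1)) \<longlonglongrightarrow> 0" by real_asymp
      show "\<forall>\<^sub>F N in sequentially. norm (t N) \<le> 2 / (real (Suc N) + 1)"
        unfolding t_def outer_tail_def real_norm_def using tail(2) by (intro always_eventually allI)
    qed
    from tendsto_mult[OF this x2(1)[unfolded sums_def]]
    show "(\<lambda>N. (\<Sum>n. odd_term s1 m (Suc (n + N))) * (\<Sum>k<N. e k * c k)) \<longlonglongrightarrow> 0"
      unfolding t by simp
    show "(\<lambda>k. e k * c k * (\<Sum>n. odd_term s1 m (Suc (n + k)))) sums X"
      unfolding t using X by (simp add: mult_ac)
  qed
  from sums_mult[OF this, of s2]
  have "(\<lambda>n. odd_term s1 m (Suc n) * (\<Sum>k\<le>n. (s2 * s2) * (even_term s2 p k * inner_sum (Suc k)))) sums (s2 * X)"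
    by (simp add: e_def c_def sum_distrib_left mult_ac)
  moreover have "s2 * s2 = 1" using signs by auto
  ultimately show ?thesis
    using that rational_polynomial_in_scale[OF sign_rats(2) \<open>reducible X\<close>] by simp
qed

end

section \<open>Index shift from the nested sum to \<open>T_triple\<close>\<close>

lemma T_triple_eq:
  fixes \<sigma>1 \<sigma>2 \<sigma>3 :: int
  assumes "(\<lambda>n. odd_term (of_int \<sigma>1) m (Suc n) * (\<Sum>k\<le>n. even_term (of_int \<sigma>2) p k *
      (\<Sum>z<Suc k. odd_term (of_int \<sigma>3) q z))) sums x"
    and \<sigma>: "\<sigma>1 \<in> {1, -1}" "\<sigma>2 \<in> {1, -1}"
  shows "T_triple m p q \<sigma>1 \<sigma>2 \<sigma>3 = 8 * of_int \<sigma>3 * x"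
proof -
  let ?a = "\<lambda>n1 n2 n3. of_int \<sigma>1 ^ n1 * of_int \<sigma>2 ^ n2 * of_int \<sigma>3 ^ n3 /
            ((2 * real n1 - 3) ^ m * (2 * real n2 - 2) ^ p * (2 * real n3 - 1) ^ q) :: real"
  let ?f = "\<lambda>n1. \<Sum>n2\<in>{1..<n1}. \<Sum>n3\<in>{1..<n2}. ?a n1 n2 n3"
  have a: "?a (n + 3) (k + 2) (Suc z) = of_int \<sigma>3 * (odd_term (of_int \<sigma>1) m (Suc n) *
      (even_term (of_int \<sigma>2) p k * odd_term (of_int \<sigma>3) q z))" for n k z
  proof -
    have e: "(of_int \<sigma>1 :: real) ^ (n + 3) = of_int \<sigma>1 ^ Suc n" "(of_int \<sigma>2 :: real) ^ (k + 2) = of_int \<sigma>2 ^ k"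
      "2 * real (n + 3) - 3 = 2 * real (Suc n) + 1" "2 * real (k + 2) - 2 = 2 * real k + 2"
      "2 * real (Suc z) - 1 = 2 * real z + 1"
      using \<sigma> by (auto simp: power_add)
    show ?thesis unfolding e by (simp add: even_term_def odd_term_def mult_ac add_ac)
  qed
  have "?f (n + 3) = of_int \<sigma>3 * (odd_term (of_int \<sigma>1) m (Suc n) * (\<Sum>k\<le>n. even_term (of_int \<sigma>2) p k *
      (\<Sum>z<Suc k. odd_term (of_int \<sigma>3) q z)))" for n
  proof -
    \<comment> \<open>At n2 = 1, where 2 n2 - 2 vanishes, the inner sum is empty, so the first
      genuine term has n1 = 3, n2 = 2, n3 = 1.\<close>
    have "{1..<n + 3} = insert 1 ((\<lambda>k. k + 2) ` {..n})"
    proof (intro set_eqI iffI)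
      fix i assume "i \<in> {1..<n + 3}"
      then show "i \<in> insert 1 ((\<lambda>k. k + 2) ` {..n})"
        by (cases "i = 1") (auto intro!: image_eqI[of _ _ "i - 2"])
    qed auto
    then have "?f (n + 3) =
        (\<Sum>n2\<in>insert 1 ((\<lambda>k. k + 2) ` {..n}). \<Sum>n3\<in>{1..<n2}. ?a (n + 3) n2 n3)" by (simp only:)
    also have "\<dots> = (\<Sum>n2\<in>(\<lambda>k. k + 2) ` {..n}. \<Sum>n3\<in>{1..<n2}. ?a (n + 3) n2 n3)"
      by (subst sum.insert) auto
    also have "\<dots> = (\<Sum>k\<le>n. \<Sum>n3\<in>{1..<k + 2}. ?a (n + 3) (k + 2) n3)"
      by (subst sum.reindex) (auto simp only: inj_on_def o_def)
    also have "\<dots> = (\<Sum>k\<le>n. \<Sum>z<Suc k. ?a (n + 3) (k + 2) (Suc z))"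
      by (intro sum.cong refl sum.reindex_bij_witness[of _ Suc "\<lambda>i. i - 1"]) auto
    finally show ?thesis unfolding a by (simp only: sum_distrib_left)
  qed
  then have "(\<lambda>n. ?f (n + 3)) sums (of_int \<sigma>3 * x)" using sums_mult[OF assms(1)] by simp
  moreover have "(\<Sum>i<3. ?f i) = 0" by (simp add: eval_nat_numeral)
  ultimately have "?f sums (of_int \<sigma>3 * x)"
    using sums_iff_shift[of ?f 3 "of_int \<sigma>3 * x"] by simp
  then show ?thesis by (simp add: T_triple_def sums_iff)
qed

theorem theorem4p9:
  fixes m p q :: nat and \<sigma>1 \<sigma>2 \<sigma>3 :: int
  assumes "m \<ge> 1" and "p \<ge> 1" and "q \<ge> 1"
    and "\<sigma>1 \<in> {1, -1}" and "\<sigma>2 \<in> {1, -1}" and "\<sigma>3 \<in> {1, -1}"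
    and "(m, \<sigma>1) \<noteq> (1, 1)" and "(p, \<sigma>2) \<noteq> (1, 1)"
    and "even (m + p + q) \<longleftrightarrow> even ((1 - \<sigma>1 * \<sigma>3) div 2)"
  shows "rational_polynomial_in
           (alt_zeta_values \<union> beta_values \<union> R_sum_values \<union> T_double_values)
           (T_triple m p q \<sigma>1 \<sigma>2 \<sigma>3)"
proof -
  interpret triple_T m p q "of_int \<sigma>1" "of_int \<sigma>2" "of_int \<sigma>3"
    using assms by unfold_locales auto
  \<comment> \<open>Half of 1 - \<sigma>1 \<sigma>3 is 0 or 1 according as the product of the two
    signs is 1 or -1, so the parity hypothesis says that this product is (-1)^w.\<close>
  have "real_of_int (\<sigma>1 * \<sigma>3) * (-1) ^ (m + p + q) = 1"
    using assms(4,6,9) by (cases "even (m + p + q)") auto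
  then have "of_int \<sigma>1 * (-1) ^ m * (-1) ^ p * (of_int \<sigma>3 * (-1) ^ q) = (1 :: real)"
    by (simp add: power_add mult_ac)
  then obtain x where x: "reducible x"
    "(\<lambda>n. odd_term (of_int \<sigma>1) m (Suc n) *
      (\<Sum>k\<le>n. even_term (of_int \<sigma>2) p k * inner_sum (Suc k))) sums x"
    by (rule reducible_nested_sum)
  have "T_triple m p q \<sigma>1 \<sigma>2 \<sigma>3 = 8 * of_int \<sigma>3 * x"
    using x(2) assms(4,5) unfolding inner_sum_def by (intro T_triple_eq) auto
  then show ?thesis using x(1) by (auto intro!: rational_polynomial_in_scale)
qed

end
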